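(* Let $X$ be a compact Riemannian (triangulable) submanifold of $\mathbb{R}^m$ with condition number $1/\tau$, and let $f:\mathbb{R}^m\to\mathbb{R}^n$ be a continuous function with modulus of continuity $\Omega$. Let $0<\delta<\sqrt{3/5}\,\tau$ and let $L=\{l_1,\ldots,l_k\}$ be a finite set of points of $X$, in general position, such that for every $p\in X$ there exists $l_j\in L$ with $\|p-l_j\|<\delta/2$. Let $U=\bigcup_{j=1}^k B_j$ be the union of the closed balls $B_j=B(l_j,\delta)$ and let $\mathcal{S}$ be the dual shape of $U$. Let $f_{\mathcal S},f_U$ be the restrictions of $f$ to $\mathcal{S}$ and $U$, fix $i\in\mathbb{Z}$, and write $\beta_{\mathcal S}=\beta_{(\mathcal S,f_{\mathcal S},i)}$, $\beta_U=\beta_{(U,f_U,i)}$. Put $\omega(\delta)=(\Omega(\delta),\ldots,\Omega(\delta))\in\mathbb{R}^n$. (1) If $(u,v)\in\Delta^+$ and $u+\omega(\delta)\prec v-\omega(\delta)$, then $$\beta_U(u-\omega(\delta),v+\omega(\delta))\le\beta_{\mathcal S}(u,v)\le\beta_U(u+\omega(\delta),v-\omega(\delta)).$$ (2) If $(\overline u,\overline v)\in\Delta^+$ is such that $\beta_U(\overline u,\overline v)\neq\beta_{\mathcal S}(\overline u,\overline v)$, then there is at least one point $(\tilde u,\tilde v)$ with $\|(\overline u,\overline v)-(\tilde u,\tilde v)\|\le\Omega(\delta)$ in the max norm, which is either an element of the boundary of $\Delta^+$ or a discontinuity point of $\beta_U$.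
   Context: $\mathbb{R}^m$ carries the Euclidean norm; $\mathbb{R}^n$ (codomain of filtering functions) and $\mathbb{R}^n\times\mathbb{R}^n$ carry the max norm. For $u,v\in\mathbb{R}^n$, $u\prec v$ (resp. $u\preceq v$) means $u_j<v_j$ (resp. $u_j\le v_j$) for all $j=1,\ldots,n$. $\Delta^+=\{(u,v)\in\mathbb{R}^n\times\mathbb{R}^n : u\prec v\}$. Persistent Betti numbers: fix a field $\mathbb{K}$. A space is triangulable if it is homeomorphic to the underlying space of a finite simplicial complex (for a submanifold of a Euclidean space, also that its triangulation can be extended to a domain containing it). For a triangulable space $Z$, a continuous $f:Z\to\mathbb{R}^n$ and $i\in\mathbb{Z}$, let $Z\langle f\preceq u\rangle=\{p\in Z: f_j(p)\le u_j,\ j=1,\ldots,n\}$; then $\beta_{(Z,f,i)}:\Delta^+\to\mathbb{N}$ is defined by letting $\beta_{(Z,f,i)}(u,v)$ be the dimension of the image of the homomorphism $\check H_i(Z\langle f\preceq u\rangle)\to\check H_i(Z\langle f\preceq v\rangle)$ induced by inclusion, where $\check H_i$ is the $i$-th Čech homology with coefficients in $\mathbb{K}$. Discontinuity points of $\beta$ are those of the function $\beta:\Delta^+\to\mathbb{N}$ ($\mathbb{N}$ discrete). Modulus of continuity of $f:\mathbb{R}^m\to\mathbb{R}^n$: $\Omega(\varepsilon)=\max_{j}\sup\{|f_j(p)-f_j(p')| : p,p'\in\mathbb{R}^m,\ \|p-p'\|\le\varepsilon\}$. Condition number $1/\tau$: the open normal bundle to $X$ of radius $s$ is $\{(p,w):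 p\in X,\ w\in T_p\mathbb{R}^m \text{ orthogonal to } T_pX,\ \|w\|<s\}$, mapped to $\mathbb{R}^m$ by $(p,w)\mapsto p+w$; $\tau$ is the largest number such that for every $s<\tau$ this map is an embedding. Dual shape: let $V_j$ be the Voronoi cell of $l_j$, i.e. the set of points of $\mathbb{R}^m$ whose distance from $l_j$ is not greater than the distance from any other $l_{j'}$, and let $V'_j=V_j\cap B_j$. For nonempty $T\subseteq\{1,\ldots,k\}$ let $\sigma_T$ be the convex hull of $\{l_j: j\in T\}$. The dual complex is $\mathcal{K}=\{\sigma_T : T\neq\emptyset,\ \bigcap_{j\in T}V'_j\neq\emptyset\}$ and the dual shape is $\mathcal{S}=|\mathcal{K}|$, the union of the simplices of $\mathcal{K}$. General position is the usual nondegeneracy for Voronoi/Delaunay constructions: no $d+2$ points of $L$ on a common $d$-dimensional affine subspace for $d<m$, and no $m+2$ points of $L$ on a common sphere. *)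

theory Defs
  imports "HOL-Analysis.Analysis" "Jordan_Normal_Form.Missing_VectorSpace"
begin

section \<open>Smooth submanifolds and the condition number\<close>

fun Ck_on :: "nat \<Rightarrow> 'a::real_normed_vector set \<Rightarrow> ('a \<Rightarrow> 'b::real_normed_vector) \<Rightarrow> bool" where
  "Ck_on 0 S f \<longleftrightarrow> continuous_on S f"
| "Ck_on (Suc k) S f \<longleftrightarrow>
     (\<forall>x\<in>S. f differentiable at x) \<and> (\<forall>v. Ck_on k S (\<lambda>x. frechet_derivative f (at x) v))"

text \<open>Meant for open \<open>S\<close> only.\<close>

definition smooth_on :: "'a::real_normed_vector set \<Rightarrow> ('a \<Rightarrow> 'b::real_normed_vector) \<Rightarrow> bool" where
  "smooth_on S f \<longleftrightarrow> (\<forall>k. Ck_on k S f)"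

text \<open>Embedded submanifolds without boundary, given by ambient slice charts.\<close>

definition smooth_submanifold :: "nat \<Rightarrow> 'a::euclidean_space set \<Rightarrow> bool" where
  "smooth_submanifold d X \<longleftrightarrow>
     (\<forall>p\<in>X. \<exists>W \<phi> \<psi> (V :: 'a set).
        open W \<and> p \<in> W \<and> open (\<phi> ` W) \<and> homeomorphism W (\<phi> ` W) \<phi> \<psi> \<and>
        smooth_on W \<phi> \<and> smooth_on (\<phi> ` W) \<psi> \<and>
        real_vector.subspace V \<and> real_vector.dim V = d \<and> \<phi> ` (W \<inter> X) = \<phi> ` W \<inter> V)"

definition tangent_space :: "'a::real_normed_vector set \<Rightarrow> 'a \<Rightarrow> 'a set" where
  "tangent_space X p =
     {v. \<exists>(\<gamma> :: real \<Rightarrow> 'a) e. e > 0 \<and> smooth_on {-e<..<e} \<gamma> \<and> \<gamma> ` {-e<..<e} \<subseteq> X \<and>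
         \<gamma> 0 = p \<and> (\<gamma> has_vector_derivative v) (at 0)}"

text \<open>\<open>F\<close> is defined on the whole ambient space, and its restriction to the submanifold \<open>A\<close> is a
  smooth embedding: an injective immersion that is a homeomorphism onto its image.\<close>

definition smooth_embedding_on ::
  "'a::real_normed_vector set \<Rightarrow> ('a \<Rightarrow> 'b::real_normed_vector) \<Rightarrow> bool" where
  "smooth_embedding_on A F \<longleftrightarrow>
     smooth_on UNIV F \<and> (\<exists>G. homeomorphism A (F ` A) F G) \<and>
     (\<forall>q\<in>A. \<forall>v\<in>tangent_space A q. frechet_derivative F (at q) v = 0 \<longrightarrow> v = 0)"

definition normal_bundle :: "'a::euclidean_space set \<Rightarrow> real \<Rightarrow> ('a \<times> 'a) set" where
  "normal_bundle X s = {(p, w). p \<in> X \<and> (\<forall>t\<in>tangent_space X p. w \<bullet> t = 0) \<and> norm w < s}"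

text \<open>The number \<open>\<tau>\<close> such that \<open>X\<close> has condition number \<open>1/\<tau>\<close>. The set below is closed under
  suprema, so its supremum is its largest element; it is \<open>\<infinity>\<close> for a one-point \<open>X\<close>, for instance.\<close>

definition tube_radius :: "'a::euclidean_space set \<Rightarrow> ereal" where
  "tube_radius X =
     Sup {t. \<forall>s. ereal s < t \<longrightarrow> smooth_embedding_on (normal_bundle X s) (\<lambda>(p, w). p + w)}"

text \<open>A finite simplicial complex can be realised in some Euclidean space, but HOL cannot quantify
  over types; the type \<open>'t\<close> of that space is therefore a parameter, universally quantified in any
  theorem with this predicate as a hypothesis. The subcomplex \<open>\<C>\<close> triangulates \<open>X\<close>, and \<open>\<D>\<close>
  triangulates the closure of a domain (connected open set) that contains \<open>X\<close>.\<close>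

definition triangulable_submanifold :: "'t::euclidean_space itself \<Rightarrow> 'a::euclidean_space set \<Rightarrow> bool" where
  "triangulable_submanifold _ X \<longleftrightarrow>
     (\<exists>(\<D> :: 't set set) \<C> h g G.
        simplicial_complex \<D> \<and> simplicial_complex \<C> \<and> \<C> \<subseteq> \<D> \<and>
        open G \<and> connected G \<and> X \<subseteq> G \<and>
        homeomorphism (\<Union>\<D>) (closure G) h g \<and> h ` \<Union>\<C> = X)"


section \<open>Dual shapes\<close>

definition voronoi_cell :: "'a::metric_space set \<Rightarrow> 'a \<Rightarrow> 'a set" where
  "voronoi_cell L l = {x. \<forall>l'\<in>L. dist x l \<le> dist x l'}"

definition dual_complex :: "'a::euclidean_space set \<Rightarrow> real \<Rightarrow> 'a set set" where
  "dual_complex L \<delta> =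
     {convex hull T |T. T \<subseteq> L \<and> T \<noteq> {} \<and> (\<Inter>l\<in>T. voronoi_cell L l \<inter> cball l \<delta>) \<noteq> {}}"

definition dual_shape :: "'a::euclidean_space set \<Rightarrow> real \<Rightarrow> 'a set" where
  "dual_shape L \<delta> = \<Union>(dual_complex L \<delta>)"

definition general_position :: "'a::euclidean_space set \<Rightarrow> bool" where
  "general_position L \<longleftrightarrow>
     (\<forall>d<DIM('a). \<forall>T\<subseteq>L. card T = d + 2 \<longrightarrow>
        \<not> (\<exists>A. affine A \<and> aff_dim A = int d \<and> T \<subseteq> A)) \<and>
     (\<forall>T\<subseteq>L. card T = DIM('a) + 2 \<longrightarrow> \<not> (\<exists>c r. T \<subseteq> sphere c r))"


section \<open>Simplicial homology with coefficients in a field\<close>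

text \<open>Homology of a finite abstract simplicial complex \<open>X\<close> (not containing the empty set), computed
  from ordered chains: a generator in degree \<open>i\<close> is a list of \<open>i + 1\<close> vertices, repetitions
  allowed, whose elements span a simplex. In negative degrees there are no generators.\<close>

definition ord_simplices :: "'v set set \<Rightarrow> int \<Rightarrow> 'v list set" where
  "ord_simplices X i = {s. set s \<in> X \<and> int (length s) = i + 1}"

definition chains :: "'v set set \<Rightarrow> int \<Rightarrow> ('v list \<Rightarrow> 'k::field) set" where
  "chains X i = {c. \<forall>s. s \<notin> ord_simplices X i \<longrightarrow> c s = 0}"

definition del_vertex :: "nat \<Rightarrow> 'v list \<Rightarrow> 'v list" where
  "del_vertex j s = take j s @ drop (Suc j) s"

definition boundary :: "'v set set \<Rightarrow> int \<Rightarrow> ('v list \<Rightarrow> 'k::field) \<Rightarrow> 'v list \<Rightarrow> 'k" where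
  "boundary X i c = (\<lambda>t. if t \<in> ord_simplices X (i - 1)
     then \<Sum>s\<in>ord_simplices X i. \<Sum>j | j < length s \<and> del_vertex j s = t. (-1) ^ j * c s
     else 0)"

definition cycles :: "'v set set \<Rightarrow> int \<Rightarrow> ('v list \<Rightarrow> 'k::field) set" where
  "cycles X i = {c \<in> chains X i. \<forall>t. boundary X i c t = 0}"

definition boundaries :: "'v set set \<Rightarrow> int \<Rightarrow> ('v list \<Rightarrow> 'k::field) set" where
  "boundaries X i = boundary X (i + 1) ` chains X (i + 1)"

definition hom_class :: "'v set set \<Rightarrow> int \<Rightarrow> ('v list \<Rightarrow> 'k::field) \<Rightarrow> ('v list \<Rightarrow> 'k) set" where
  "hom_class X i z = {\<lambda>s. z s + b s |b. b \<in> boundaries X i}"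

text \<open>The record type \<open>module\<close> extends rings, so a multiplication and a unit have to be supplied;
  they play no role.\<close>

definition simplicial_homology ::
  "'v set set \<Rightarrow> int \<Rightarrow> ('k::field, ('v list \<Rightarrow> 'k) set) module" where
  "simplicial_homology X i =
     \<lparr>carrier = hom_class X i ` cycles X i,
      mult = undefined, one = undefined,
      zero = hom_class X i (\<lambda>_. 0),
      add = (\<lambda>A B. {\<lambda>s. a s + b s |a b. a \<in> A \<and> b \<in> B}),
      smult = (\<lambda>r A. \<Union>a\<in>A. hom_class X i (\<lambda>s. r * a s))\<rparr>"

definition push_chain ::
  "'v set set \<Rightarrow> int \<Rightarrow> ('v \<Rightarrow> 'w) \<Rightarrow> ('v list \<Rightarrow> 'k::field) \<Rightarrow> 'w list \<Rightarrow> 'k" where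
  "push_chain X i p c = (\<lambda>t. \<Sum>s | s \<in> ord_simplices X i \<and> map p s = t. c s)"

definition induced_hom ::
  "'v set set \<Rightarrow> 'w set set \<Rightarrow> int \<Rightarrow> ('v \<Rightarrow> 'w) \<Rightarrow> ('v list \<Rightarrow> 'k::field) set \<Rightarrow> ('w list \<Rightarrow> 'k) set" where
  "induced_hom X Y i p A = (\<Union>a\<in>A. hom_class Y i (push_chain X i p a))"


section \<open>Cech homology\<close>

definition finite_open_covers :: "'a::topological_space set \<Rightarrow> 'a set set set" where
  "finite_open_covers Z =
     {\<U>. finite \<U> \<and> (\<forall>U\<in>\<U>. openin (top_of_set Z) U) \<and> \<Union>\<U> = Z}"

definition nerve :: "'a set set \<Rightarrow> 'a set set set" where
  "nerve \<U> = {\<sigma>. \<sigma> \<subseteq> \<U> \<and> finite \<sigma> \<and> \<sigma> \<noteq> {} \<and> \<Inter>\<sigma> \<noteq> {}}"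

definition refines :: "'a set set \<Rightarrow> 'a set set \<Rightarrow> bool" where
  "refines \<W> \<V> \<longleftrightarrow> (\<forall>W\<in>\<W>. \<exists>V\<in>\<V>. W \<subseteq> V)"

text \<open>The homomorphism between the homologies of the nerves that is induced by some projection
  \<open>\<W> \<rightarrow> \<V>\<close>; as any two projections are contiguous, it does not depend on the choice.\<close>

definition nerve_hom ::
  "int \<Rightarrow> 'a set set \<Rightarrow> 'a set set \<Rightarrow> ('a set list \<Rightarrow> 'k::field) set \<Rightarrow> ('a set list \<Rightarrow> 'k) set" where
  "nerve_hom i \<W> \<V> =
     induced_hom (nerve \<W>) (nerve \<V>) i (SOME p. \<forall>W\<in>\<W>. p W \<in> \<V> \<and> W \<subseteq> p W)"

text \<open>The inverse limit over the finite open covers, which are cofinal among all open covers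
  since only compact spaces are considered.\<close>

definition cech_homology ::
  "'a::topological_space set \<Rightarrow> int \<Rightarrow>
     ('k::field, 'a set set \<Rightarrow> ('a set list \<Rightarrow> 'k) set) module" where
  "cech_homology Z i =
     \<lparr>carrier = {h \<in> (\<Pi>\<^sub>E \<U>\<in>finite_open_covers Z. carrier (simplicial_homology (nerve \<U>) i)).
        \<forall>\<W>\<in>finite_open_covers Z. \<forall>\<V>\<in>finite_open_covers Z.
          refines \<W> \<V> \<longrightarrow> nerve_hom i \<W> \<V> (h \<W>) = h \<V>},
      mult = undefined, one = undefined,
      zero = (\<lambda>\<U>\<in>finite_open_covers Z. \<zero>\<^bsub>simplicial_homology (nerve \<U>) i\<^esub>),
      add = (\<lambda>g h. \<lambda>\<U>\<in>finite_open_covers Z. g \<U> \<oplus>\<^bsub>simplicial_homology (nerve \<U>) i\<^esub> h \<U>),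
      smult = (\<lambda>r h. \<lambda>\<U>\<in>finite_open_covers Z. r \<odot>\<^bsub>simplicial_homology (nerve \<U>) i\<^esub> h \<U>)\<rparr>"

text \<open>The homomorphism induced by an inclusion \<open>A \<subseteq> B\<close>: a cover \<open>\<V>\<close> of \<open>B\<close> restricts to a cover
  of \<open>A\<close>, which as a family of sets refines \<open>\<V>\<close>.\<close>

definition cech_inclusion ::
  "'a::topological_space set \<Rightarrow> 'a set \<Rightarrow> int \<Rightarrow>
     ('a set set \<Rightarrow> ('a set list \<Rightarrow> 'k::field) set) \<Rightarrow> ('a set set \<Rightarrow> ('a set list \<Rightarrow> 'k) set)" where
  "cech_inclusion A B i h =
     (\<lambda>\<V>\<in>finite_open_covers B. nerve_hom i ((\<lambda>V. V \<inter> A) ` \<V>) \<V> (h ((\<lambda>V. V \<inter> A) ` \<V>)))"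


section \<open>Persistent Betti numbers\<close>

text \<open>The strict order on vectors in the library, unlike \<open>prec\<close>, only asks for one strict component.\<close>

definition prec :: "real ^ 'n \<Rightarrow> real ^ 'n \<Rightarrow> bool" where
  "prec u v \<longleftrightarrow> (\<forall>j. u $ j < v $ j)"

definition Delta_plus :: "((real ^ 'n) \<times> (real ^ 'n)) set" where
  "Delta_plus = {(u, v). prec u v}"

definition sublevel :: "'a set \<Rightarrow> ('a \<Rightarrow> real ^ 'n) \<Rightarrow> real ^ 'n \<Rightarrow> 'a set" where
  "sublevel Z f u = {p \<in> Z. \<forall>j. f p $ j \<le> u $ j}"

abbreviation field_ring :: "'k::field ring" where
  "field_ring \<equiv> \<lparr>carrier = UNIV, mult = (*), one = 1, zero = 0, add = (+)\<rparr>"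

definition edim :: "('k, 'c, 'e) module_scheme \<Rightarrow> 'k ring \<Rightarrow> enat" where
  "edim V K = (if vectorspace.fin_dim K V then enat (vectorspace.dim K V) else \<infinity>)"

text \<open>For compact triangulable \<open>Z\<close>, continuous \<open>f\<close> and \<open>prec u v\<close> the dimension is finite; the
  codomain \<^typ>\<open>enat\<close> avoids an arbitrary natural number elsewhere.\<close>

definition persistent_betti ::
  "'k::field itself \<Rightarrow> 'a::topological_space set \<Rightarrow> ('a \<Rightarrow> real ^ 'n) \<Rightarrow> int \<Rightarrow>
     real ^ 'n \<Rightarrow> real ^ 'n \<Rightarrow> enat" where
  "persistent_betti _ Z f i u v =
     (let A = sublevel Z f u; B = sublevel Z f v;
          H = (cech_homology B i :: ('k, 'a set set \<Rightarrow> ('a set list \<Rightarrow> 'k) set) module)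
      in edim (H\<lparr>carrier := cech_inclusion A B i ` carrier (cech_homology A i)\<rparr>) field_ring)"

definition discontinuity_point :: "(real ^ 'n \<Rightarrow> real ^ 'n \<Rightarrow> enat) \<Rightarrow> (real ^ 'n) \<times> (real ^ 'n) \<Rightarrow> bool" where
  "discontinuity_point \<beta> x \<longleftrightarrow> x \<in> Delta_plus \<and>
     \<not> topcontinuous_at (top_of_set Delta_plus) (discrete_topology UNIV) (\<lambda>(u, v). \<beta> u v) x"

text \<open>Possibly \<open>\<infinity>\<close>, since \<open>f\<close> need not be uniformly continuous.\<close>

definition modulus_of_continuity :: "('a::real_normed_vector \<Rightarrow> real ^ 'n) \<Rightarrow> real \<Rightarrow> ereal" where
  "modulus_of_continuity f \<epsilon> =
     Max (range (\<lambda>j. Sup {ereal \<bar>f p $ j - f p' $ j\<bar> |p p'. norm (p - p') \<le> \<epsilon>}))"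

end

theory Submission
  imports Defs
begin

text \<open>The union of balls \<open>U\<close> deforms onto its dual shape \<open>S\<close> in such a way that no point moves by more
  than \<open>\<delta>\<close>, so \<open>f\<close> changes by at most \<open>\<Omega>(\<delta>)\<close> along the deformation and the sublevel sets of \<open>U\<close> and
  \<open>S\<close> are interleaved up to homotopy. The retraction sends \<open>p\<close> to the \<open>x\<close> in the decomposition
  \<open>p = (1 - t) x + t y\<close>, where \<open>x\<close> lies in the Delaunay cell dual to the Voronoi face of \<open>y\<close>. This \<open>x\<close>
  is unique because the assignment of Delaunay cells to points is a monotone operator, being the
  subdifferential of a convex function. For \<open>t\<close> close to \<open>1\<close> it carries \<open>U\<close> into \<open>S\<close>, and the segment
  from \<open>p\<close> to \<open>x\<close> stays in every ball whose centre is nearest to \<open>p\<close>. On \<open>S\<close>, letting \<open>t\<close> run down to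
  \<open>0\<close> deforms the retraction inside \<open>S\<close> to the identity.

  For Cech homology, two maps that send each point into a common member of a cover \<open>\<V>\<close> induce
  contiguous maps into the nerve of \<open>\<V>\<close>; a homotopy from a compact space is a finite chain of such
  pairs.

  If no discontinuity point of \<open>\<beta>\<^sub>U\<close> and no boundary point of \<open>\<Delta>\<^sup>+\<close> lies within \<open>\<Omega>(\<delta>)\<close> of a point, then
  \<open>\<beta>\<^sub>U\<close> is constant on the max-norm ball around it, and both bounds in the first claim coincide.\<close>

section \<open>Simplicial chains\<close>

text \<open>Chain maps and chain homotopies are described by their transposes, which act on arbitrary
  functions on lists by recursion; no finiteness is then involved in the homotopy identity.\<close>

fun coboundary :: "('v list \<Rightarrow> 'k::comm_ring_1) \<Rightarrow> 'v list \<Rightarrow> 'k" where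
  "coboundary \<phi> [] = 0"
| "coboundary \<phi> (v # s) = \<phi> s - coboundary (\<lambda>r. \<phi> (v # r)) s"

text \<open>On \<open>[v0, ..., vn]\<close> this is the alternating sum over \<open>j\<close> of
  \<open>\<phi>\<close> at \<open>[p v0, ..., p vj, q vj, ..., q vn]\<close>: the transpose of the
  classical prism operator between two vertex maps.\<close>

fun prism :: "('v \<Rightarrow> 'w) \<Rightarrow> ('v \<Rightarrow> 'w) \<Rightarrow> ('w list \<Rightarrow> 'k::comm_ring_1) \<Rightarrow> 'v list \<Rightarrow> 'k" where
  "prism p q \<phi> [] = 0"
| "prism p q \<phi> (v # s) = \<phi> (p v # q v # map q s) - prism p q (\<lambda>r. \<phi> (p v # r)) s"

lemma coboundary_diff: "coboundary (\<lambda>r. \<phi> r - \<psi> r) s = coboundary \<phi> s - coboundary \<psi> s"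
  by (induction s arbitrary: \<phi> \<psi>) simp_all

lemma prism_diff: "prism p q (\<lambda>r. \<phi> r - \<psi> r) s = prism p q \<phi> s - prism p q \<psi> s"
  by (induction s arbitrary: \<phi> \<psi>) simp_all

lemma coboundary_zero: "coboundary (\<lambda>r. 0) s = 0"
  by (induction s) simp_all

lemma prism_zero: "prism p q (\<lambda>r. 0) s = 0"
  by (induction s) simp_all

lemma coboundary_add: "coboundary (\<lambda>r. \<phi> r + \<psi> r) s = coboundary \<phi> s + coboundary \<psi> s"
  by (induction s arbitrary: \<phi> \<psi>) simp_all

lemma prism_add: "prism p q (\<lambda>r. \<phi> r + \<psi> r) s = prism p q \<phi> s + prism p q \<psi> s"
  by (induction s arbitrary: \<phi> \<psi>) simp_all

lemma coboundary_mult: "coboundary (\<lambda>r. a * \<phi> r) s = a * coboundary \<phi> s"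
  by (induction s arbitrary: \<phi>) (simp_all add: algebra_simps)

lemma prism_mult: "prism p q (\<lambda>r. a * \<phi> r) s = a * prism p q \<phi> s"
  by (induction s arbitrary: \<phi>) (simp_all add: algebra_simps)

lemma coboundary_sum: "coboundary (\<lambda>r. \<Sum>t\<in>A. c t * \<phi> t r) s = (\<Sum>t\<in>A. c t * coboundary (\<phi> t) s)"
  by (induction A rule: infinite_finite_induct)
    (simp_all add: coboundary_zero coboundary_add coboundary_mult)

lemma prism_sum: "prism p q (\<lambda>r. \<Sum>t\<in>A. c t * \<phi> t r) s = (\<Sum>t\<in>A. c t * prism p q (\<phi> t) s)"
  by (induction A rule: infinite_finite_induct) (simp_all add: prism_zero prism_add prism_mult)

lemma coboundary_map: "coboundary (\<lambda>r. \<phi> (map p r)) s = coboundary \<phi> (map p s)"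
  by (induction s arbitrary: \<phi>) simp_all

text \<open>After the first vertex is split off, the terms with prefix \<open>p v # q v\<close>
  cancel, and the rest telescopes with the identity for \<open>\<lambda>r. \<phi> (p v # r)\<close>
  on the tail; hence \<open>\<phi>\<close> stays arbitrary in the induction.\<close>

lemma prism_homotopy:
  "prism p q (coboundary \<phi>) s + coboundary (prism p q \<phi>) s = \<phi> (map q s) - \<phi> (map p s)"
proof (induction s arbitrary: \<phi>)
  case (Cons v s)
  have "coboundary (\<lambda>r. \<phi> (p v # q v # map q r)) s
      = coboundary (\<lambda>r. \<phi> (p v # q v # r)) (map q s)"
    by (rule coboundary_map)
  then show ?case
    using Cons.IH[of "\<lambda>r. \<phi> (p v # r)"] Cons.IH[of \<phi>]
    by (simp add: coboundary_diff prism_diff algebra_simps)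
qed simp

text \<open>Connects the recursion with the signed vertex deletions that \<open>boundary\<close> is
  built from.\<close>

lemma coboundary_alternating:
  "coboundary \<phi> s = (\<Sum>j<length s. (-1) ^ j * \<phi> (del_vertex j s))"
proof (induction s arbitrary: \<phi>)
  case (Cons v s)
  have "(\<Sum>j<length (v # s). (-1) ^ j * \<phi> (del_vertex j (v # s)))
      = \<phi> s - (\<Sum>j<length s. (-1) ^ j * \<phi> (v # del_vertex j s))"
    by (simp only: length_Cons sum.lessThan_Suc_shift) (simp add: del_vertex_def sum_negf)
  then show ?case
    by (simp add: Cons.IH)
qed simp

lemma coboundary_cong:
  assumes "\<And>j. j < length s \<Longrightarrow> \<phi> (del_vertex j s) = \<psi> (del_vertex j s)"
  shows "coboundary \<phi> s = coboundary \<psi> s"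
  using assms by (simp add: coboundary_alternating)

text \<open>Only lists with vertices from the two images of \<open>s\<close> are evaluated. Under
  contiguity these span simplices, so \<open>\<phi>\<close> may be altered outside the
  complex.\<close>

lemma prism_cong:
  assumes "\<And>r. length r = Suc (length s) \<Longrightarrow> set r \<subseteq> p ` set s \<union> q ` set s \<Longrightarrow> \<phi> r = \<psi> r"
  shows "prism p q \<phi> s = prism p q \<psi> s"
  using assms
proof (induction s arbitrary: \<phi> \<psi>)
  case (Cons v s)
  have "prism p q (\<lambda>r. \<phi> (p v # r)) s = prism p q (\<lambda>r. \<psi> (p v # r)) s"
    by (rule Cons.IH, rule Cons.prems) auto
  moreover have "\<phi> (p v # q v # map q s) = \<psi> (p v # q v # map q s)"
    by (rule Cons.prems) auto
  ultimately show ?case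
    by simp
qed simp

section \<open>Boundary and push-forward as adjoints of the recursive operators\<close>

definition finite_complex :: "'v set set \<Rightarrow> bool" where
  "finite_complex X \<longleftrightarrow> finite X \<and>
     (\<forall>\<sigma>\<in>X. finite \<sigma> \<and> \<sigma> \<noteq> {} \<and> (\<forall>\<rho>. \<rho> \<subseteq> \<sigma> \<longrightarrow> \<rho> \<noteq> {} \<longrightarrow> \<rho> \<in> X))"

lemma finite_ord_simplices:
  assumes "finite_complex X"
  shows "finite (ord_simplices X i)"
proof (rule finite_subset)
  show "ord_simplices X i \<subseteq> {s. set s \<subseteq> \<Union>X \<and> length s \<le> nat (i + 1)}"
    by (auto simp: ord_simplices_def)
  show "finite {s. set s \<subseteq> \<Union>X \<and> length s \<le> nat (i + 1)}"
    using assms by (intro finite_lists_length_le) (auto simp: finite_complex_def)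
qed

lemma del_vertex_ord_simplices:
  assumes "finite_complex X" "s \<in> ord_simplices X i" "j < length s" "del_vertex j s \<noteq> []"
  shows "del_vertex j s \<in> ord_simplices X (i - 1)"
proof -
  have "set (del_vertex j s) \<subseteq> set s"
    by (auto simp: del_vertex_def dest: in_set_takeD in_set_dropD)
  then have "set (del_vertex j s) \<in> X"
    using assms by (auto simp: finite_complex_def ord_simplices_def)
  moreover have "length (del_vertex j s) = length s - 1"
    using assms(3) by (simp add: del_vertex_def)
  ultimately show ?thesis
    using assms by (auto simp: ord_simplices_def)
qed

lemma Nil_notin_ord_simplices: "finite_complex X \<Longrightarrow> [] \<notin> ord_simplices X i"
  by (auto simp: finite_complex_def ord_simplices_def)

text \<open>Turns the face count of \<open>boundary\<close> into a pairing with a coboundary, so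
  that identities for the recursive operators transfer to chains.\<close>

lemma boundary_eq_sum:
  assumes "t \<in> ord_simplices X (i - 1)"
  shows "boundary X i c t = (\<Sum>s\<in>ord_simplices X i. c s * coboundary (\<lambda>r. of_bool (r = t)) s)"
proof -
  have "(\<Sum>j | j < length s \<and> del_vertex j s = t. (-1) ^ j * c s)
      = c s * coboundary (\<lambda>r. of_bool (r = t)) s" for s
  proof -
    have "(\<Sum>j | j < length s \<and> del_vertex j s = t. (-1) ^ j * c s)
        = (\<Sum>j<length s. if del_vertex j s = t then (-1) ^ j * c s else 0)"
      by (subst sum.inter_filter[symmetric]) (auto intro!: sum.cong)
    also have "\<dots> = c s * coboundary (\<lambda>r. of_bool (r = t)) s"
      unfolding coboundary_alternating sum_distrib_left by (intro sum.cong) auto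
    finally show ?thesis .
  qed
  then show ?thesis
    using assms by (simp add: boundary_def)
qed

lemma boundary_outside: "t \<notin> ord_simplices X (i - 1) \<Longrightarrow> boundary X i c t = 0"
  by (simp add: boundary_def)

text \<open>Boundary and coboundary are adjoint. The recursive \<open>coboundary\<close> is
  augmented: on a one-vertex list it returns \<open>\<psi> []\<close>, while \<open>boundary\<close>
  vanishes in degree 0. The condition on \<open>\<psi> []\<close> reconciles the two.\<close>

lemma sum_boundary:
  assumes X: "finite_complex X" and "\<psi> [] = 0"
  shows "(\<Sum>r\<in>ord_simplices X (i - 1). \<psi> r * boundary X i c r)
       = (\<Sum>s\<in>ord_simplices X i. c s * coboundary \<psi> s)"
proof -
  let ?O = "ord_simplices X (i - 1)"
  have fin: "finite ?O"
    using X by (rule finite_ord_simplices)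
  have "(\<Sum>r\<in>?O. \<psi> r * boundary X i c r)
      = (\<Sum>r\<in>?O. \<Sum>s\<in>ord_simplices X i. c s * (\<psi> r * coboundary (\<lambda>r'. of_bool (r' = r)) s))"
    by (intro sum.cong refl) (simp add: boundary_eq_sum sum_distrib_left mult_ac)
  also have "\<dots> = (\<Sum>s\<in>ord_simplices X i. c s * (\<Sum>r\<in>?O. \<psi> r * coboundary (\<lambda>r'. of_bool (r' = r)) s))"
    by (subst sum.swap) (simp add: sum_distrib_left)
  also have "\<dots> = (\<Sum>s\<in>ord_simplices X i. c s * coboundary (\<lambda>r'. \<Sum>r\<in>?O. \<psi> r * of_bool (r' = r)) s)"
    by (simp only: coboundary_sum)
  \<comment> \<open>Each face that is evaluated is either the empty list or an ordered simplex, and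
    there \<open>\<psi>\<close> agrees with its expansion in indicator functions.\<close>
  also have "\<dots> = (\<Sum>s\<in>ord_simplices X i. c s * coboundary \<psi> s)"
  proof (intro sum.cong refl, rule arg_cong[where f = "(*) _"], rule coboundary_cong)
    fix s j assume s: "s \<in> ord_simplices X i" "j < length s"
    show "(\<Sum>r\<in>?O. \<psi> r * of_bool (del_vertex j s = r)) = \<psi> (del_vertex j s)"
    proof (cases "del_vertex j s = []")
      case True
      then show ?thesis
        using Nil_notin_ord_simplices[OF X] assms(2) by (auto intro!: sum.neutral)
    next
      case False
      then have "del_vertex j s \<in> ?O"
        using X s by (intro del_vertex_ord_simplices)
      then show ?thesis
        using fin by (simp add: of_bool_def if_distrib[of "(*) _"] cong: if_cong)
    qed
  qed
  finally show ?thesis .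
qed

definition simplicial_map :: "('v \<Rightarrow> 'w) \<Rightarrow> 'v set set \<Rightarrow> 'w set set \<Rightarrow> bool" where
  "simplicial_map p X Y \<longleftrightarrow> (\<forall>\<sigma>\<in>X. p ` \<sigma> \<in> Y)"

lemma map_ord_simplices:
  "simplicial_map p X Y \<Longrightarrow> s \<in> ord_simplices X i \<Longrightarrow> map p s \<in> ord_simplices Y i"
  by (auto simp: simplicial_map_def ord_simplices_def)

lemma push_chain_eq_sum:
  assumes "finite_complex X"
  shows "push_chain X i p c t = (\<Sum>s\<in>ord_simplices X i. c s * of_bool (map p s = t))"
proof -
  have "push_chain X i p c t = (\<Sum>s\<in>{s \<in> ord_simplices X i. map p s = t}. c s)"
    by (simp add: push_chain_def)
  also have "\<dots> = (\<Sum>s\<in>ord_simplices X i. if map p s = t then c s else 0)"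
    by (rule sum.inter_filter) (simp add: assms finite_ord_simplices)
  also have "\<dots> = (\<Sum>s\<in>ord_simplices X i. c s * of_bool (map p s = t))"
    by (intro sum.cong) auto
  finally show ?thesis .
qed

lemma push_chain_outside:
  "simplicial_map p X Y \<Longrightarrow> t \<notin> ord_simplices Y i \<Longrightarrow> push_chain X i p c t = 0"
  by (auto simp: push_chain_def intro!: sum.neutral dest: map_ord_simplices)

text \<open>Adjointness again: the transpose of \<open>push_chain\<close> is composition with
  \<open>map p\<close>.\<close>

lemma sum_push_chain:
  assumes "finite_complex X" "finite_complex Y" "simplicial_map p X Y"
  shows "(\<Sum>t\<in>ord_simplices Y i. \<psi> t * push_chain X i p c t)
       = (\<Sum>s\<in>ord_simplices X i. c s * \<psi> (map p s))"
proof -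
  have "(\<Sum>t\<in>ord_simplices Y i. \<psi> t * push_chain X i p c t)
      = (\<Sum>s\<in>ord_simplices X i. \<Sum>t\<in>ord_simplices Y i. \<psi> t * (c s * of_bool (map p s = t)))"
    by (subst sum.swap) (simp add: push_chain_eq_sum assms(1) sum_distrib_left)
  also have "\<dots> = (\<Sum>s\<in>ord_simplices X i. c s * \<psi> (map p s))"
  proof (intro sum.cong refl)
    fix s assume "s \<in> ord_simplices X i"
    then have "map p s \<in> ord_simplices Y i"
      using assms(3) by (rule map_ord_simplices[rotated])
    then show "(\<Sum>t\<in>ord_simplices Y i. \<psi> t * (c s * of_bool (map p s = t))) = c s * \<psi> (map p s)"
      using finite_ord_simplices[OF assms(2)]
      by (simp add: of_bool_def if_distrib[of "(*) _"] cong: if_cong)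
  qed
  finally show ?thesis .
qed

text \<open>By adjointness both sides pair \<open>c\<close> with the same function, because
  \<open>coboundary\<close> commutes with \<open>map p\<close>.\<close>

lemma boundary_push_chain:
  assumes X: "finite_complex X" and Y: "finite_complex Y" and p: "simplicial_map p X Y"
  shows "boundary Y i (push_chain X i p c) = push_chain X (i - 1) p (boundary X i c)"
proof
  fix t
  show "boundary Y i (push_chain X i p c) t = push_chain X (i - 1) p (boundary X i c) t"
  proof (cases "t \<in> ord_simplices Y (i - 1)")
    case True
    then have "t \<noteq> []"
      using Nil_notin_ord_simplices[OF Y] by blast
    have "boundary Y i (push_chain X i p c) t
        = (\<Sum>s\<in>ord_simplices X i. c s * coboundary (\<lambda>r. of_bool (r = t)) (map p s))"
      using sum_push_chain[OF assms, of "coboundary (\<lambda>r. of_bool (r = t))" i c]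
      by (simp add: boundary_eq_sum True mult.commute)
    also have "\<dots> = (\<Sum>s\<in>ord_simplices X i. c s * coboundary (\<lambda>r. of_bool (map p r = t)) s)"
      by (simp add: coboundary_map[of "\<lambda>r. of_bool (r = t)"])
    also have "\<dots> = (\<Sum>r\<in>ord_simplices X (i - 1). of_bool (map p r = t) * boundary X i c r)"
      using X \<open>t \<noteq> []\<close> by (subst sum_boundary) auto
    also have "\<dots> = push_chain X (i - 1) p (boundary X i c) t"
      by (simp add: push_chain_eq_sum X mult.commute)
    finally show ?thesis .
  qed (simp add: boundary_outside push_chain_outside[OF p])
qed

lemma push_chain_comp:
  assumes "finite_complex X" "finite_complex Y" "simplicial_map p X Y"
  shows "push_chain Y i q (push_chain X i p c) = push_chain X i (q \<circ> p) c"
proof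
  fix t
  have "push_chain Y i q (push_chain X i p c) t
      = (\<Sum>s\<in>ord_simplices Y i. of_bool (map q s = t) * push_chain X i p c s)"
    by (simp only: push_chain_eq_sum[OF assms(2)]) (simp only: mult.commute)
  then show "push_chain Y i q (push_chain X i p c) t = push_chain X i (q \<circ> p) c t"
    by (simp only: sum_push_chain[OF assms]) (simp add: push_chain_eq_sum[OF assms(1)])
qed

definition contiguous :: "('v \<Rightarrow> 'w) \<Rightarrow> ('v \<Rightarrow> 'w) \<Rightarrow> 'v set set \<Rightarrow> 'w set set \<Rightarrow> bool" where
  "contiguous p q X Y \<longleftrightarrow> (\<forall>\<sigma>\<in>X. p ` \<sigma> \<union> q ` \<sigma> \<in> Y)"

lemma contiguous_simplicial_map:
  assumes "finite_complex X" "finite_complex Y" "contiguous p q X Y"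
  shows "simplicial_map p X Y" "simplicial_map q X Y"
  using assms
  by (auto simp: simplicial_map_def contiguous_def finite_complex_def)

text \<open>The prism is a chain homotopy. On a cycle one of its two terms disappears, and the
  difference of the push-forwards is the boundary of the prism over \<open>z\<close>.\<close>

lemma push_chain_contiguous:
  fixes z :: "'v list \<Rightarrow> 'k::field" and Y :: "'w set set"
  assumes X: "finite_complex X" and Y: "finite_complex Y" and pq: "contiguous p q X Y"
    and z: "z \<in> cycles X i"
  shows "(\<lambda>t. push_chain X i q z t - push_chain X i p z t) \<in> boundaries Y i"
proof -
  note maps = contiguous_simplicial_map[OF X Y pq]
  \<comment> \<open>The prism chain over \<open>z\<close>: its coefficient at \<open>t\<close> pairs
    \<open>z\<close> with the transposed prism of the indicator function of
    \<open>t\<close>.\<close>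
  define w where "w = (\<lambda>t. if t \<in> ord_simplices Y (i + 1)
    then \<Sum>s\<in>ord_simplices X i. z s * prism p q (\<lambda>r. of_bool (r = t)) s else 0)"
  have "boundary Y (i + 1) w t = push_chain X i q z t - push_chain X i p z t" for t
  proof (cases "t \<in> ord_simplices Y i")
    case True
    let ?O = "ord_simplices Y (i + 1)"
    let ?d = "coboundary (\<lambda>r. of_bool (r = t)) :: 'w list \<Rightarrow> 'k"
    have "boundary Y (i + 1) w t = (\<Sum>r\<in>?O. w r * ?d r)"
      using True by (simp add: boundary_eq_sum)
    also have "\<dots> = (\<Sum>r\<in>?O. \<Sum>s\<in>ord_simplices X i. z s * (?d r * prism p q (\<lambda>r'. of_bool (r' = r)) s))"
      by (intro sum.cong refl) (simp add: w_def sum_distrib_left mult_ac)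
    also have "\<dots> = (\<Sum>s\<in>ord_simplices X i. z s * prism p q (\<lambda>r'. \<Sum>r\<in>?O. ?d r * of_bool (r' = r)) s)"
      by (subst sum.swap) (simp add: sum_distrib_left prism_sum)
    \<comment> \<open>Restricting to \<open>?O\<close> loses nothing: by contiguity, every list
      reached by the prism over a simplex \<open>s\<close> spans a simplex of
      \<open>Y\<close>.\<close>
    also have "\<dots> = (\<Sum>s\<in>ord_simplices X i. z s * prism p q ?d s)"
    proof (intro sum.cong refl, rule arg_cong[where f = "(*) _"], rule prism_cong)
      fix s r assume s: "s \<in> ord_simplices X i"
        and r: "length r = Suc (length s)" "set r \<subseteq> p ` set s \<union> q ` set s"
      then have "p ` set s \<union> q ` set s \<in> Y"
        using pq by (auto simp: contiguous_def ord_simplices_def)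
      moreover have "set r \<noteq> {}"
        using r(1) by (cases r) auto
      ultimately have "set r \<in> Y"
        using Y r by (auto simp: finite_complex_def)
      then have "r \<in> ?O"
        using r s by (auto simp: ord_simplices_def)
      then show "(\<Sum>r'\<in>?O. ?d r' * of_bool (r = r')) = ?d r"
        using finite_ord_simplices[OF Y]
        by (simp add: of_bool_def if_distrib[of "(*) _"] cong: if_cong)
    qed
    also have "\<dots> = (\<Sum>s\<in>ord_simplices X i. z s * (of_bool (map q s = t) - of_bool (map p s = t)
        - coboundary (prism p q (\<lambda>r. of_bool (r = t))) s))"
    proof -
      have "prism p q ?d s = of_bool (map q s = t) - of_bool (map p s = t)
          - coboundary (prism p q (\<lambda>r. of_bool (r = t))) s" for s
        using prism_homotopy[of p q "\<lambda>r. of_bool (r = t)" s] by (simp only: eq_diff_eq)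
      then show ?thesis
        by simp
    qed
    also have "\<dots> = push_chain X i q z t - push_chain X i p z t
        - (\<Sum>s\<in>ord_simplices X i. z s * coboundary (prism p q (\<lambda>r. of_bool (r = t))) s)"
      by (simp add: push_chain_eq_sum[OF X] right_diff_distrib sum_subtractf)
    \<comment> \<open>By adjointness this pairs the prism with \<open>boundary X i z\<close>, which
      is zero.\<close>
    also have "(\<Sum>s\<in>ord_simplices X i. z s * coboundary (prism p q (\<lambda>r. of_bool (r = t))) s) = 0"
      using z by (subst sum_boundary[OF X, symmetric]) (simp_all add: cycles_def)
    finally show ?thesis
      by simp
  qed (simp add: boundary_outside push_chain_outside[OF maps(1)] push_chain_outside[OF maps(2)])
  moreover have "w \<in> chains Y (i + 1)"
    by (simp add: chains_def w_def)
  ultimately show ?thesis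
    by (auto simp: boundaries_def intro!: image_eqI[of _ _ w])
qed

section \<open>Homology classes and their linear structure\<close>

lemma boundary_add: "boundary X i (\<lambda>s. a s + b s) = (\<lambda>t. boundary X i a t + boundary X i b t)"
  by (auto simp: boundary_def fun_eq_iff algebra_simps sum.distrib)

lemma boundary_mult: "boundary X i (\<lambda>s. r * a s) = (\<lambda>t. r * boundary X i a t)"
  by (auto simp: boundary_def fun_eq_iff sum_distrib_left mult_ac)

lemma push_chain_add:
  "push_chain X i p (\<lambda>s. a s + b s) = (\<lambda>t. push_chain X i p a t + push_chain X i p b t)"
  by (simp add: push_chain_def fun_eq_iff sum.distrib)

lemma push_chain_mult: "push_chain X i p (\<lambda>s. r * a s) = (\<lambda>t. r * push_chain X i p a t)"
  by (simp add: push_chain_def fun_eq_iff sum_distrib_left)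

lemma zero_cycles: "(\<lambda>s. 0) \<in> cycles X i"
  by (simp add: cycles_def chains_def boundary_def)

lemma cycles_add: "a \<in> cycles X i \<Longrightarrow> b \<in> cycles X i \<Longrightarrow> (\<lambda>s. a s + b s) \<in> cycles X i"
  by (simp add: cycles_def chains_def boundary_add)

lemma cycles_mult: "a \<in> cycles X i \<Longrightarrow> (\<lambda>s. r * a s) \<in> cycles X i"
  by (simp add: cycles_def chains_def boundary_mult)

lemma boundaries_add:
  assumes "a \<in> boundaries X i" "b \<in> boundaries X i"
  shows "(\<lambda>s. a s + b s) \<in> boundaries X i"
proof -
  obtain a' b' where "a = boundary X (i + 1) a'" "b = boundary X (i + 1) b'"
    "a' \<in> chains X (i + 1)" "b' \<in> chains X (i + 1)"
    using assms by (auto simp: boundaries_def)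
  then show ?thesis
    by (auto simp: boundaries_def chains_def boundary_add intro!: image_eqI[of _ _ "\<lambda>s. a' s + b' s"])
qed

lemma boundaries_mult:
  assumes "a \<in> boundaries X i"
  shows "(\<lambda>s. r * a s) \<in> boundaries X i"
proof -
  obtain a' where "a = boundary X (i + 1) a'" "a' \<in> chains X (i + 1)"
    using assms by (auto simp: boundaries_def)
  then show ?thesis
    by (auto simp: boundaries_def chains_def boundary_mult intro!: image_eqI[of _ _ "\<lambda>s. r * a' s"])
qed

lemma zero_boundaries: "(\<lambda>s. 0) \<in> boundaries X i"
  by (auto simp: boundaries_def chains_def boundary_def fun_eq_iff intro!: image_eqI[of _ _ "\<lambda>s. 0"])

lemma boundaries_diff:
  assumes "a \<in> boundaries X i" "b \<in> boundaries X i"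
  shows "(\<lambda>s. a s - b s) \<in> boundaries X i"
  using boundaries_add[OF assms(1) boundaries_mult[OF assms(2), of "-1"]] by simp

lemma mem_hom_class: "a \<in> hom_class X i z \<longleftrightarrow> (\<lambda>s. a s - z s) \<in> boundaries X i"
proof
  show "(\<lambda>s. a s - z s) \<in> boundaries X i" if "a \<in> hom_class X i z"
    using that by (auto simp: hom_class_def)
  show "a \<in> hom_class X i z" if "(\<lambda>s. a s - z s) \<in> boundaries X i"
    unfolding hom_class_def by (rule CollectI, rule exI[of _ "\<lambda>s. a s - z s"]) (simp add: that)
qed

lemma hom_class_eq_iff:
  "hom_class X i a = hom_class X i b \<longleftrightarrow> (\<lambda>s. a s - b s) \<in> boundaries X i"
proof
  assume "hom_class X i a = hom_class X i b"
  moreover have "a \<in> hom_class X i a"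
    by (simp add: mem_hom_class zero_boundaries)
  ultimately show "(\<lambda>s. a s - b s) \<in> boundaries X i"
    by (simp add: mem_hom_class)
next
  assume ab: "(\<lambda>s. a s - b s) \<in> boundaries X i"
  show "hom_class X i a = hom_class X i b"
  proof (intro Set.set_eqI)
    fix c
    show "c \<in> hom_class X i a \<longleftrightarrow> c \<in> hom_class X i b"
      unfolding mem_hom_class
      using boundaries_add[OF _ ab, of "\<lambda>s. c s - a s"] boundaries_diff[OF _ ab, of "\<lambda>s. c s - b s"]
      by (auto simp: algebra_simps)
  qed
qed

lemma hom_class_self: "a \<in> hom_class X i a"
  by (simp add: mem_hom_class zero_boundaries)

lemma simplicial_homology_add:
  "hom_class X i a \<oplus>\<^bsub>simplicial_homology X i\<^esub> hom_class X i b = hom_class X i (\<lambda>s. a s + b s)"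
proof (rule Set.set_eqI)
  fix c
  have "c \<in> hom_class X i (\<lambda>s. a s + b s)"
    if "a' \<in> hom_class X i a" "b' \<in> hom_class X i b" "c = (\<lambda>s. a' s + b' s)" for a' b'
    using boundaries_add[OF that(1,2)[unfolded mem_hom_class]] that(3)
    by (simp add: mem_hom_class algebra_simps)
  moreover have "\<exists>a' b'. c = (\<lambda>s. a' s + b' s) \<and> a' \<in> hom_class X i a \<and> b' \<in> hom_class X i b"
    if "c \<in> hom_class X i (\<lambda>s. a s + b s)"
    using that by (intro exI[of _ a] exI[of _ "\<lambda>s. c s - a s"])
      (simp add: mem_hom_class zero_boundaries algebra_simps)
  ultimately show "c \<in> hom_class X i a \<oplus>\<^bsub>simplicial_homology X i\<^esub> hom_class X i b \<longleftrightarrow>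
      c \<in> hom_class X i (\<lambda>s. a s + b s)"
    by (auto simp: simplicial_homology_def)
qed

lemma simplicial_homology_smult:
  "r \<odot>\<^bsub>simplicial_homology X i\<^esub> hom_class X i a = hom_class X i (\<lambda>s. r * a s)"
proof -
  have "hom_class X i (\<lambda>s. r * a' s) = hom_class X i (\<lambda>s. r * a s)" if "a' \<in> hom_class X i a" for a'
    using boundaries_mult[OF that[unfolded mem_hom_class], of r]
    by (simp add: hom_class_eq_iff algebra_simps)
  then have "r \<odot>\<^bsub>simplicial_homology X i\<^esub> hom_class X i a
      = (\<Union>a'\<in>hom_class X i a. hom_class X i (\<lambda>s. r * a s))"
    by (simp add: simplicial_homology_def)
  then show ?thesis
    using hom_class_self by fastforce
qed

lemma simplicial_homology_zero: "\<zero>\<^bsub>simplicial_homology X i\<^esub> = hom_class X i (\<lambda>s. 0)"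
  by (simp add: simplicial_homology_def)

lemma carrier_simplicial_homology: "carrier (simplicial_homology X i) = hom_class X i ` cycles X i"
  by (simp add: simplicial_homology_def)

lemma push_chain_chains:
  assumes "simplicial_map p X Y"
  shows "push_chain X i p c \<in> chains Y i"
  using push_chain_outside[OF assms] by (auto simp: chains_def)

lemma push_chain_boundaries:
  assumes "finite_complex X" "finite_complex Y" "simplicial_map p X Y" "b \<in> boundaries X i"
  shows "push_chain X i p b \<in> boundaries Y i"
proof -
  obtain c where "b = boundary X (i + 1) c"
    using assms(4) by (auto simp: boundaries_def)
  then have "push_chain X i p b = boundary Y (i + 1) (push_chain X (i + 1) p c)"
    using boundary_push_chain[OF assms(1-3), of "i + 1" c] by simp
  then show ?thesis
    using push_chain_chains[OF assms(3)] by (auto simp: boundaries_def)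
qed

lemma push_chain_cycles:
  assumes "finite_complex X" "finite_complex Y" "simplicial_map p X Y" "z \<in> cycles X i"
  shows "push_chain X i p z \<in> cycles Y i"
proof -
  have "boundary X i z = (\<lambda>t. 0)"
    using assms(4) by (auto simp: cycles_def)
  then have "boundary Y i (push_chain X i p z) t = 0" for t
    unfolding boundary_push_chain[OF assms(1-3)] by (simp add: push_chain_def)
  then show ?thesis
    using push_chain_chains[OF assms(3)] by (auto simp: cycles_def)
qed

text \<open>The union over all representatives collapses: push-forward preserves boundaries, so
  every member of the class has the same image class.\<close>

lemma induced_hom_hom_class:
  assumes "finite_complex X" "finite_complex Y" "simplicial_map p X Y"
  shows "induced_hom X Y i p (hom_class X i z) = hom_class Y i (push_chain X i p z)"
proof -
  have "hom_class Y i (push_chain X i p a) = hom_class Y i (push_chain X i p z)"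
    if "a \<in> hom_class X i z" for a
  proof -
    have "push_chain X i p (\<lambda>s. a s - z s) \<in> boundaries Y i"
      using assms that by (intro push_chain_boundaries) (auto simp: mem_hom_class)
    moreover have "push_chain X i p (\<lambda>s. a s - z s)
        = (\<lambda>t. push_chain X i p a t - push_chain X i p z t)"
      by (simp add: push_chain_def sum_subtractf)
    ultimately show ?thesis
      by (simp add: hom_class_eq_iff)
  qed
  then have "induced_hom X Y i p (hom_class X i z)
      = (\<Union>a\<in>hom_class X i z. hom_class Y i (push_chain X i p z))"
    by (simp add: induced_hom_def)
  then show ?thesis
    using hom_class_self by fastforce
qed

lemma induced_hom_closed:
  assumes "finite_complex X" "finite_complex Y" "simplicial_map p X Y"
    "A \<in> carrier (simplicial_homology X i)"
  shows "induced_hom X Y i p A \<in> carrier (simplicial_homology Y i)"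
  using assms push_chain_cycles[OF assms(1-3)]
  by (auto simp: carrier_simplicial_homology induced_hom_hom_class intro!: imageI)

lemma induced_hom_comp:
  assumes "finite_complex X" "finite_complex Y" "finite_complex Z"
    "simplicial_map p X Y" "simplicial_map q Y Z" "A \<in> carrier (simplicial_homology X i)"
  shows "induced_hom Y Z i q (induced_hom X Y i p A) = induced_hom X Z i (q \<circ> p) A"
proof -
  have "simplicial_map (q \<circ> p) X Z"
    using assms by (simp add: simplicial_map_def image_comp[symmetric] del: comp_apply)
  then show ?thesis
    using assms by (auto simp: carrier_simplicial_homology induced_hom_hom_class push_chain_comp)
qed

lemma induced_hom_contiguous:
  assumes "finite_complex X" "finite_complex Y" "contiguous p q X Y"
    "A \<in> carrier (simplicial_homology X i)"
  shows "induced_hom X Y i p A = induced_hom X Y i q A"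
proof -
  obtain z where z: "z \<in> cycles X i" "A = hom_class X i z"
    using assms(4) by (auto simp: carrier_simplicial_homology)
  have "hom_class Y i (push_chain X i q z) = hom_class Y i (push_chain X i p z)"
    unfolding hom_class_eq_iff by (rule push_chain_contiguous[OF assms(1-3) z(1)])
  then show ?thesis
    using contiguous_simplicial_map[OF assms(1-3)] assms(1,2) z by (simp add: induced_hom_hom_class)
qed

lemma induced_hom_add:
  assumes "finite_complex X" "finite_complex Y" "simplicial_map p X Y"
    "A \<in> carrier (simplicial_homology X i)" "B \<in> carrier (simplicial_homology X i)"
  shows "induced_hom X Y i p (A \<oplus>\<^bsub>simplicial_homology X i\<^esub> B)
    = induced_hom X Y i p A \<oplus>\<^bsub>simplicial_homology Y i\<^esub> induced_hom X Y i p B"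
  using assms by (auto simp: carrier_simplicial_homology simplicial_homology_add
      induced_hom_hom_class push_chain_add)

lemma induced_hom_smult:
  assumes "finite_complex X" "finite_complex Y" "simplicial_map p X Y"
    "A \<in> carrier (simplicial_homology X i)"
  shows "induced_hom X Y i p (r \<odot>\<^bsub>simplicial_homology X i\<^esub> A)
    = r \<odot>\<^bsub>simplicial_homology Y i\<^esub> induced_hom X Y i p A"
  using assms by (auto simp: carrier_simplicial_homology simplicial_homology_smult
      induced_hom_hom_class push_chain_mult)


section \<open>Cech homology of continuous maps\<close>

lemma finite_complex_nerve:
  assumes "finite \<U>"
  shows "finite_complex (nerve \<U>)"
proof -
  have "nerve \<U> \<subseteq> Pow \<U>"
    by (auto simp: nerve_def)
  then have "finite (nerve \<U>)"
    using assms by (simp add: finite_subset)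
  moreover have "\<rho> \<in> nerve \<U>" if "\<sigma> \<in> nerve \<U>" "\<rho> \<subseteq> \<sigma>" "\<rho> \<noteq> {}" for \<sigma> \<rho>
  proof -
    have "\<Inter>\<sigma> \<subseteq> \<Inter>\<rho>"
      using that(2) by (rule Inter_anti_mono)
    then show ?thesis
      using that finite_subset[OF that(2)] unfolding nerve_def by blast
  qed
  moreover have "finite \<sigma> \<and> \<sigma> \<noteq> {}" if "\<sigma> \<in> nerve \<U>" for \<sigma>
    using that by (simp add: nerve_def)
  ultimately show ?thesis
    unfolding finite_complex_def by blast
qed

lemma finite_open_coversD:
  assumes "\<U> \<in> finite_open_covers Z"
  shows "finite \<U>" "finite_complex (nerve \<U>)" "\<Union>\<U> = Z" "U \<in> \<U> \<Longrightarrow> openin (top_of_set Z) U"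
  using assms finite_complex_nerve by (auto simp: finite_open_covers_def)

text \<open>With the identity for \<open>g\<close> this is a refinement projection; a general
  \<open>g\<close> treats refinements, inclusions and continuous maps in one way.\<close>

definition cover_map :: "('a \<Rightarrow> 'b) \<Rightarrow> 'a set set \<Rightarrow> 'b set set \<Rightarrow> ('a set \<Rightarrow> 'b set) \<Rightarrow> bool" where
  "cover_map g \<W> \<V> p \<longleftrightarrow> (\<forall>W\<in>\<W>. p W \<in> \<V> \<and> g ` W \<subseteq> p W)"

lemma cover_mapD:
  assumes "cover_map g \<W> \<V> p" "W \<in> \<W>"
  shows "p W \<in> \<V>" "x \<in> W \<Longrightarrow> g x \<in> p W"
  using assms by (auto simp: cover_map_def)

lemma cover_map_exists:
  assumes "\<And>W. W \<in> \<W> \<Longrightarrow> \<exists>V\<in>\<V>. g ` W \<subseteq> V"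
  obtains p where "cover_map g \<W> \<V> p"
proof -
  have "\<forall>W\<in>\<W>. \<exists>V. V \<in> \<V> \<and> g ` W \<subseteq> V"
    using assms by blast
  from bchoice[OF this] that show thesis
    unfolding cover_map_def by blast
qed

lemma cover_map_comp:
  "cover_map g \<W> \<V> p \<Longrightarrow> cover_map h \<V> \<U> q \<Longrightarrow> cover_map (h \<circ> g) \<W> \<U> (q \<circ> p)"
  unfolding cover_map_def image_subset_iff comp_def by blast

text \<open>If \<open>a\<close> is common to all members of a simplex, then \<open>g a\<close> lies
  in every set chosen by \<open>p\<close> or by \<open>q\<close>, so all of these still have a
  common point.\<close>

lemma cover_map_contiguous:
  assumes "cover_map g \<W> \<V> p" "cover_map g \<W> \<V> q"
  shows "contiguous p q (nerve \<W>) (nerve \<V>)"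
  unfolding contiguous_def
proof
  fix \<sigma> assume \<sigma>: "\<sigma> \<in> nerve \<W>"
  then obtain a where "\<forall>W\<in>\<sigma>. a \<in> W"
    by (auto simp: nerve_def)
  moreover have "\<sigma> \<subseteq> \<W>"
    using \<sigma> by (simp add: nerve_def)
  ultimately have "g a \<in> p W" "g a \<in> q W" "p W \<in> \<V>" "q W \<in> \<V>" if "W \<in> \<sigma>" for W
    using cover_mapD[OF assms(1), of W] cover_mapD[OF assms(2), of W] that by auto
  then have "g a \<in> \<Inter>(p ` \<sigma> \<union> q ` \<sigma>)" "p ` \<sigma> \<union> q ` \<sigma> \<subseteq> \<V>"
    by auto
  then show "p ` \<sigma> \<union> q ` \<sigma> \<in> nerve \<V>"
    using \<sigma> unfolding nerve_def by blast
qed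

lemma cover_map_simplicial_map:
  assumes "cover_map g \<W> \<V> p"
  shows "simplicial_map p (nerve \<W>) (nerve \<V>)"
  using cover_map_contiguous[OF assms assms] by (simp add: contiguous_def simplicial_map_def)

definition nerve_map ::
  "('a \<Rightarrow> 'b) \<Rightarrow> int \<Rightarrow> 'a set set \<Rightarrow> 'b set set \<Rightarrow> ('a set list \<Rightarrow> 'k::field) set \<Rightarrow> ('b set list \<Rightarrow> 'k) set"
where
  "nerve_map g i \<W> \<V> = induced_hom (nerve \<W>) (nerve \<V>) i (SOME p. cover_map g \<W> \<V> p)"

text \<open>Vertex maps over the same \<open>g\<close> are contiguous, so the choice made by
  \<open>SOME\<close> is immaterial.\<close>

lemma nerve_map_eq:
  assumes "finite \<W>" "finite \<V>" "cover_map g \<W> \<V> p"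
    "A \<in> carrier (simplicial_homology (nerve \<W>) i)"
  shows "nerve_map g i \<W> \<V> A = induced_hom (nerve \<W>) (nerve \<V>) i p A"
proof -
  have "cover_map g \<W> \<V> (SOME p. cover_map g \<W> \<V> p)"
    using assms(3) by (rule someI[of "cover_map g \<W> \<V>" p])
  then show ?thesis
    unfolding nerve_map_def using assms
    by (intro induced_hom_contiguous cover_map_contiguous[where g = g] finite_complex_nerve)
qed

lemma nerve_hom_eq_nerve_map: "nerve_hom i \<W> \<V> = nerve_map (\<lambda>x. x) i \<W> \<V>"
  by (simp add: nerve_hom_def nerve_map_def cover_map_def)

definition preimage_cover :: "'a set \<Rightarrow> ('a \<Rightarrow> 'b) \<Rightarrow> 'b set set \<Rightarrow> 'a set set" where
  "preimage_cover A g \<V> = (\<lambda>V. g -` V \<inter> A) ` \<V>"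

definition cech_map ::
  "'a::topological_space set \<Rightarrow> 'b::topological_space set \<Rightarrow> ('a \<Rightarrow> 'b) \<Rightarrow> int \<Rightarrow>
     ('a set set \<Rightarrow> ('a set list \<Rightarrow> 'k::field) set) \<Rightarrow> ('b set set \<Rightarrow> ('b set list \<Rightarrow> 'k) set)" where
  "cech_map A B g i h =
     (\<lambda>\<V>\<in>finite_open_covers B. nerve_map g i (preimage_cover A g \<V>) \<V> (h (preimage_cover A g \<V>)))"

lemma cech_inclusion_eq_cech_map: "cech_inclusion A B i = cech_map A B (\<lambda>x. x) i"
  by (simp add: fun_eq_iff cech_inclusion_def cech_map_def preimage_cover_def nerve_hom_eq_nerve_map)

lemma preimage_cover_finite_open_covers:
  assumes "continuous_on A g" "g ` A \<subseteq> B" "\<V> \<in> finite_open_covers B"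
  shows "preimage_cover A g \<V> \<in> finite_open_covers A"
proof -
  have "openin (top_of_set A) (g -` V \<inter> A)" if "V \<in> \<V>" for V
    using continuous_openin_preimage[OF assms(1), of B V] assms that
    by (auto simp: finite_open_covers_def Int_commute image_subset_iff_funcset)
  moreover have "\<Union>(preimage_cover A g \<V>) = A"
    using assms unfolding preimage_cover_def finite_open_covers_def by blast
  ultimately show ?thesis
    using assms(3) by (auto simp: preimage_cover_def finite_open_covers_def)
qed

lemma preimage_cover_cover_map:
  obtains p where "cover_map g (preimage_cover A g \<V>) \<V> p"
  by (rule cover_map_exists[of "preimage_cover A g \<V>" \<V> g]) (auto simp: preimage_cover_def)

section \<open>Evaluating Cech classes through arbitrary covers\<close>

context
  fixes A :: "'a::topological_space set" and i :: int
    and h :: "'a set set \<Rightarrow> ('a set list \<Rightarrow> 'k::field) set"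
  assumes h: "h \<in> carrier (cech_homology A i)"
begin

lemma cech_homology_component:
  "\<U> \<in> finite_open_covers A \<Longrightarrow> h \<U> \<in> carrier (simplicial_homology (nerve \<U>) i)"
  using h by (auto simp: cech_homology_def)

lemma cech_homology_compatible:
  assumes "\<W> \<in> finite_open_covers A" "\<V> \<in> finite_open_covers A" "cover_map (\<lambda>x. x) \<W> \<V> p"
  shows "induced_hom (nerve \<W>) (nerve \<V>) i p (h \<W>) = h \<V>"
proof -
  have "refines \<W> \<V>"
    using assms(3) by (auto simp: refines_def cover_map_def)
  then have "nerve_hom i \<W> \<V> (h \<W>) = h \<V>"
    using assms h by (simp add: cech_homology_def)
  then show ?thesis
    using nerve_map_eq[OF _ _ assms(3) cech_homology_component[OF assms(1)]] assms(1,2)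
    by (simp add: nerve_hom_eq_nerve_map finite_open_coversD(1))
qed

text \<open>Over the common refinement \<open>\<M>\<close> by pairwise intersections, both sides are
  images of \<open>h \<M>\<close> under vertex maps over the same \<open>g\<close>, and these are
  contiguous.\<close>

lemma cech_homology_cover_independent:
  assumes "\<W> \<in> finite_open_covers A" "\<W>' \<in> finite_open_covers A" "finite \<V>"
    and "cover_map g \<W> \<V> p" "cover_map g \<W>' \<V> p'"
  shows "induced_hom (nerve \<W>) (nerve \<V>) i p (h \<W>) = induced_hom (nerve \<W>') (nerve \<V>) i p' (h \<W>')"
proof -
  define \<M> where "\<M> = (\<lambda>(W, W'). W \<inter> W') ` (\<W> \<times> \<W>')"
  have \<M>: "\<M> \<in> finite_open_covers A"
    unfolding finite_open_covers_def
  proof (intro CollectI conjI ballI)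
    show "finite \<M>" "\<Union>\<M> = A"
      using finite_open_coversD(1,3)[OF assms(1)] finite_open_coversD(1,3)[OF assms(2)]
      by (auto simp: \<M>_def)
    show "openin (top_of_set A) U" if "U \<in> \<M>" for U
      using that finite_open_coversD(4)[OF assms(1)] finite_open_coversD(4)[OF assms(2)]
      by (auto simp: \<M>_def)
  qed
  obtain q where q: "cover_map (\<lambda>x. x) \<M> \<W> q"
    by (rule cover_map_exists[of \<M> \<W> "\<lambda>x. x"]) (auto simp: \<M>_def)
  obtain q' where q': "cover_map (\<lambda>x. x) \<M> \<W>' q'"
    by (rule cover_map_exists[of \<M> \<W>' "\<lambda>x. x"]) (auto simp: \<M>_def)
  have *: "induced_hom (nerve \<W>) (nerve \<V>) i p (h \<W>) = induced_hom (nerve \<M>) (nerve \<V>) i (p \<circ> q) (h \<M>)"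
    if "\<W> \<in> finite_open_covers A" "cover_map g \<W> \<V> p" "cover_map (\<lambda>x. x) \<M> \<W> q" for \<W> p q
  proof -
    have "induced_hom (nerve \<W>) (nerve \<V>) i p (h \<W>)
        = induced_hom (nerve \<W>) (nerve \<V>) i p (induced_hom (nerve \<M>) (nerve \<W>) i q (h \<M>))"
      by (simp add: cech_homology_compatible \<M> that)
    also have "\<dots> = induced_hom (nerve \<M>) (nerve \<V>) i (p \<circ> q) (h \<M>)"
      using that \<M> assms(3)
      by (intro induced_hom_comp cech_homology_component finite_complex_nerve)
        (auto intro: cover_map_simplicial_map finite_open_coversD)
    finally show ?thesis .
  qed
  have "cover_map g \<M> \<V> (p \<circ> q)" "cover_map g \<M> \<V> (p' \<circ> q')"
    using cover_map_comp[OF q assms(4)] cover_map_comp[OF q' assms(5)] by (simp_all add: comp_def)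
  then have "induced_hom (nerve \<M>) (nerve \<V>) i (p \<circ> q) (h \<M>) = induced_hom (nerve \<M>) (nerve \<V>) i (p' \<circ> q') (h \<M>)"
    using \<M> assms(3)
    by (intro induced_hom_contiguous cover_map_contiguous[where g = g] cech_homology_component finite_complex_nerve)
      (auto intro: finite_open_coversD)
  then show ?thesis
    using *[OF assms(1,4) q] *[OF assms(2,5) q'] by simp
qed

text \<open>Frees \<open>cech_map\<close> from preimage covers: the cover of \<open>A\<close> can be
  adapted to the situation, for instance to two maps at once.\<close>

lemma cech_map_apply:
  assumes "continuous_on A g" "g ` A \<subseteq> B" "\<V> \<in> finite_open_covers B"
    and "\<W> \<in> finite_open_covers A" "cover_map g \<W> \<V> p"
  shows "cech_map A B g i h \<V> = induced_hom (nerve \<W>) (nerve \<V>) i p (h \<W>)"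
proof -
  note pre = preimage_cover_finite_open_covers[OF assms(1-3)]
  obtain q where q: "cover_map g (preimage_cover A g \<V>) \<V> q"
    by (rule preimage_cover_cover_map)
  have "cech_map A B g i h \<V> = induced_hom (nerve (preimage_cover A g \<V>)) (nerve \<V>) i q (h (preimage_cover A g \<V>))"
    using assms(3) pre q
    by (simp add: cech_map_def nerve_map_eq finite_open_coversD(1) cech_homology_component)
  also have "\<dots> = induced_hom (nerve \<W>) (nerve \<V>) i p (h \<W>)"
    using assms pre q by (intro cech_homology_cover_independent) (auto dest: finite_open_coversD)
  finally show ?thesis .
qed

lemma cech_map_closed:
  assumes "continuous_on A g" "g ` A \<subseteq> B"
  shows "cech_map A B g i h \<in> carrier (cech_homology B i)"
proof -
  have closed: "cech_map A B g i h \<V> \<in> carrier (simplicial_homology (nerve \<V>) i)"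
    if \<V>: "\<V> \<in> finite_open_covers B" for \<V>
  proof -
    note pre = preimage_cover_finite_open_covers[OF assms \<V>]
    obtain p where p: "cover_map g (preimage_cover A g \<V>) \<V> p"
      by (rule preimage_cover_cover_map)
    show ?thesis
      unfolding cech_map_apply[OF assms \<V> pre p]
      by (intro induced_hom_closed cech_homology_component pre cover_map_simplicial_map[OF p]
          finite_open_coversD(2)[OF pre] finite_open_coversD(2)[OF \<V>])
  qed
  moreover have "nerve_hom i \<W> \<V> (cech_map A B g i h \<W>) = cech_map A B g i h \<V>"
    if \<W>: "\<W> \<in> finite_open_covers B" and \<V>: "\<V> \<in> finite_open_covers B" and ref: "refines \<W> \<V>" for \<W> \<V>
  proof -
    note pre = preimage_cover_finite_open_covers[OF assms \<W>]
    obtain p where p: "cover_map g (preimage_cover A g \<W>) \<W> p"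
      by (rule preimage_cover_cover_map)
    obtain r where r: "cover_map (\<lambda>x. x) \<W> \<V> r"
      by (rule cover_map_exists[of \<W> \<V> "\<lambda>x. x"]) (use ref in \<open>auto simp: refines_def\<close>)
    have rp: "cover_map g (preimage_cover A g \<W>) \<V> (r \<circ> p)"
      using cover_map_comp[OF p r] by (simp add: comp_def)
    have "nerve_hom i \<W> \<V> (cech_map A B g i h \<W>)
        = induced_hom (nerve \<W>) (nerve \<V>) i r (cech_map A B g i h \<W>)"
      unfolding nerve_hom_eq_nerve_map using \<W> \<V> r closed
      by (intro nerve_map_eq) (auto dest: finite_open_coversD(1))
    also have "\<dots> = induced_hom (nerve (preimage_cover A g \<W>)) (nerve \<V>) i (r \<circ> p) (h (preimage_cover A g \<W>))"
      unfolding cech_map_apply[OF assms \<W> pre p]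
      by (intro induced_hom_comp cech_homology_component pre cover_map_simplicial_map[OF p]
          cover_map_simplicial_map[OF r] finite_open_coversD(2)[OF pre]
          finite_open_coversD(2)[OF \<V>] finite_open_coversD(2)[OF \<W>])
    also have "\<dots> = cech_map A B g i h \<V>"
      by (rule cech_map_apply[OF assms \<V> pre rp, symmetric])
    finally show ?thesis .
  qed
  moreover have "cech_map A B g i h \<in> extensional (finite_open_covers B)"
    by (simp add: cech_map_def)
  ultimately show ?thesis
    by (auto simp: cech_homology_def PiE_def)
qed

text \<open>The sets on which both maps land in one member \<open>V\<close> form a cover of
  \<open>A\<close> that has a single vertex map over \<open>f\<close> and over \<open>g\<close>, so
  one simplicial map computes both components.\<close>

lemma cech_map_close:
  assumes f: "continuous_on A f" "f ` A \<subseteq> B" and g: "continuous_on A g" "g ` A \<subseteq> B"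
    and \<V>: "\<V> \<in> finite_open_covers B"
    and close: "\<And>a. a \<in> A \<Longrightarrow> \<exists>V\<in>\<V>. f a \<in> V \<and> g a \<in> V"
  shows "cech_map A B f i h \<V> = cech_map A B g i h \<V>"
proof -
  define \<W> where "\<W> = (\<lambda>V. (A \<inter> f -` V) \<inter> (A \<inter> g -` V)) ` \<V>"
  have "openin (top_of_set A) ((A \<inter> f -` V) \<inter> (A \<inter> g -` V))" if "V \<in> \<V>" for V
    using f g finite_open_coversD(4)[OF \<V> that]
    by (intro openin_Int continuous_openin_preimage) auto
  moreover have "\<Union>\<W> = A"
    using close by (auto simp: \<W>_def)
  ultimately have \<W>: "\<W> \<in> finite_open_covers A"
    using finite_open_coversD(1)[OF \<V>] by (auto simp: \<W>_def finite_open_covers_def)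
  have "\<exists>p. \<forall>W\<in>\<W>. p W \<in> \<V> \<and> f ` W \<subseteq> p W \<and> g ` W \<subseteq> p W"
    by (rule bchoice) (auto simp: \<W>_def)
  then obtain p where "\<forall>W\<in>\<W>. p W \<in> \<V> \<and> f ` W \<subseteq> p W \<and> g ` W \<subseteq> p W" ..
  then have "cover_map f \<W> \<V> p" "cover_map g \<W> \<V> p"
    by (simp_all add: cover_map_def)
  then show ?thesis
    using f g \<V> \<W> by (simp add: cech_map_apply)
qed

end

lemma cech_map_comp:
  assumes f: "continuous_on A f" "f ` A \<subseteq> B" and g: "continuous_on B g" "g ` B \<subseteq> C"
    and h: "h \<in> carrier (cech_homology A i)"
  shows "cech_map B C g i (cech_map A B f i h) = cech_map A C (g \<circ> f) i h"
proof (rule extensionalityI[of _ "finite_open_covers C"])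
  fix \<V> assume \<V>: "\<V> \<in> finite_open_covers C"
  note pre = preimage_cover_finite_open_covers[OF g \<V>]
  note pre2 = preimage_cover_finite_open_covers[OF f pre]
  obtain p where p: "cover_map g (preimage_cover B g \<V>) \<V> p"
    by (rule preimage_cover_cover_map)
  obtain q where q: "cover_map f (preimage_cover A f (preimage_cover B g \<V>)) (preimage_cover B g \<V>) q"
    by (rule preimage_cover_cover_map)
  have gf: "continuous_on A (g \<circ> f)" "(g \<circ> f) ` A \<subseteq> C"
    using f g by (auto intro!: continuous_on_compose intro: continuous_on_subset simp del: comp_apply)
      (auto simp: image_subset_iff)
  have "cech_map B C g i (cech_map A B f i h) \<V>
      = induced_hom (nerve (preimage_cover B g \<V>)) (nerve \<V>) i p
          (induced_hom (nerve (preimage_cover A f (preimage_cover B g \<V>))) (nerve (preimage_cover B g \<V>)) i q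
            (h (preimage_cover A f (preimage_cover B g \<V>))))"
    using cech_map_apply[OF cech_map_closed[OF h f] g \<V> pre p] cech_map_apply[OF h f pre pre2 q] by simp
  also have "\<dots> = induced_hom (nerve (preimage_cover A f (preimage_cover B g \<V>))) (nerve \<V>) i (p \<circ> q)
      (h (preimage_cover A f (preimage_cover B g \<V>)))"
    by (intro induced_hom_comp cech_homology_component[OF h] pre2 cover_map_simplicial_map[OF p]
          cover_map_simplicial_map[OF q] finite_open_coversD(2)[OF pre]
          finite_open_coversD(2)[OF \<V>] finite_open_coversD(2)[OF pre2])
  also have "\<dots> = cech_map A C (g \<circ> f) i h \<V>"
    by (rule cech_map_apply[OF h gf \<V> pre2 cover_map_comp[OF q p], symmetric])
  finally show "cech_map B C g i (cech_map A B f i h) \<V> = cech_map A C (g \<circ> f) i h \<V>" .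
qed (simp_all add: cech_map_def)

text \<open>Equality is checked on one cover at a time, so the number of time steps may depend on
  the cover. A Lebesgue number makes consecutive steps close in the sense of
  \<open>cech_map_close\<close>.\<close>

lemma cech_map_homotopic:
  fixes A :: "'a::metric_space set" and B :: "'b::topological_space set"
  assumes "compact A" "homotopic_with_canon (\<lambda>_. True) A B f g"
    and h: "h \<in> carrier (cech_homology A i)"
  shows "cech_map A B f i h = cech_map A B g i h"
proof -
  obtain H :: "real \<times> 'a \<Rightarrow> 'b" where "continuous_map (prod_topology (top_of_set {0..1::real}) (top_of_set A)) (top_of_set B) H"
    and H01: "\<And>x. H (0, x) = f x" "\<And>x. H (1, x) = g x"
    using assms(2) by (auto simp: homotopic_with_def)
  then have H: "continuous_on ({0..1} \<times> A) H" "H ` ({0..1} \<times> A) \<subseteq> B"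
    by (auto simp: continuous_map_subtopology_eu)
  have Hs: "continuous_on A (\<lambda>x. H (s, x))" "(\<lambda>x. H (s, x)) ` A \<subseteq> B" if "s \<in> {0..1}" for s
    using that H(2) by (auto intro!: continuous_on_compose2[OF H(1)] continuous_intros)
  show ?thesis
  proof (rule extensionalityI[of _ "finite_open_covers B"])
    fix \<V> assume \<V>: "\<V> \<in> finite_open_covers B"
    let ?K = "{0..1::real} \<times> A"
    \<comment> \<open>The Lebesgue number lemma works with open sets of the ambient space, so each
      relatively open preimage is replaced by such a set \<open>T V\<close>.\<close>
    have "\<forall>V\<in>\<V>. \<exists>T. open T \<and> ?K \<inter> H -` V = ?K \<inter> T"
    proof
      fix V assume "V \<in> \<V>"
      then have "openin (top_of_set ?K) (?K \<inter> H -` V)"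
        using H finite_open_coversD(4)[OF \<V>] by (intro continuous_openin_preimage[of _ _ B]) auto
      then show "\<exists>T. open T \<and> ?K \<inter> H -` V = ?K \<inter> T"
        by (simp add: openin_open)
    qed
    from bchoice[OF this] obtain T where T: "\<forall>V\<in>\<V>. open (T V) \<and> ?K \<inter> H -` V = ?K \<inter> T V" ..
    then have mem_T: "x \<in> T V \<longleftrightarrow> H x \<in> V" if "V \<in> \<V>" "x \<in> ?K" for x V
      using that by (metis IntD2 IntI vimageD vimageI)
    have cover: "?K \<subseteq> \<Union> (insert {} (T ` \<V>))"
    proof
      fix x assume x: "x \<in> ?K"
      then have "H x \<in> \<Union>\<V>"
        using H(2) finite_open_coversD(3)[OF \<V>] by auto
      then obtain V where "V \<in> \<V>" "H x \<in> V" ..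
      then show "x \<in> \<Union> (insert {} (T ` \<V>))"
        using mem_T[of V x] x by auto
    qed
    \<comment> \<open>The inserted \<open>{}\<close> keeps the family nonempty even for an empty
      cover; the two-point sets considered below never lie in it.\<close>
    obtain \<delta> where "0 < \<delta>"
      and \<delta>: "\<And>K. K \<subseteq> ?K \<Longrightarrow> diameter K < \<delta> \<Longrightarrow> \<exists>W\<in>insert {} (T ` \<V>). K \<subseteq> W"
    proof (rule Lebesgue_number_lemma[of ?K "insert {} (T ` \<V>)"])
      show "compact ?K"
        using assms(1) by (intro compact_Times) auto
      show "\<And>W. W \<in> insert {} (T ` \<V>) \<Longrightarrow> open W"
        using T by auto
    qed (use cover in auto)
    obtain N where N: "inverse (real (Suc N)) < \<delta>"
      using reals_Archimedean[OF \<open>0 < \<delta>\<close>] by blast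
    define s where "s k = real k / real (Suc N)" for k
    have "cech_map A B (\<lambda>x. H (s k, x)) i h \<V> = cech_map A B (\<lambda>x. H (0, x)) i h \<V>" if "k \<le> Suc N" for k
      using that
    proof (induction k)
      case (Suc k)
      have s01: "s k \<in> {0..1}" "s (Suc k) \<in> {0..1}"
        using Suc.prems by (auto simp: s_def field_simps)
      have "\<exists>V\<in>\<V>. H (s k, a) \<in> V \<and> H (s (Suc k), a) \<in> V" if a: "a \<in> A" for a
      proof -
        have "dist (s k, a) (s (Suc k), a) = inverse (real (Suc N))"
          by (simp add: s_def dist_Pair_Pair dist_real_def real_sqrt_divide divide_simps)
        then have "diameter {(s k, a), (s (Suc k), a)} \<le> inverse (real (Suc N))"
          by (auto simp: diameter_def dist_commute cSup_eq_Max)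
        then have "diameter {(s k, a), (s (Suc k), a)} < \<delta>"
          using N by simp
        then have "\<exists>W\<in>insert {} (T ` \<V>). {(s k, a), (s (Suc k), a)} \<subseteq> W"
          using s01 a by (intro \<delta>) auto
        then obtain V where V: "V \<in> \<V>" "(s k, a) \<in> T V" "(s (Suc k), a) \<in> T V"
          by auto
        then show ?thesis
          using mem_T[OF V(1)] s01 a by auto
      qed
      then have "cech_map A B (\<lambda>x. H (s k, x)) i h \<V> = cech_map A B (\<lambda>x. H (s (Suc k), x)) i h \<V>"
        using Hs s01 by (intro cech_map_close[OF h _ _ _ _ \<V>]) auto
      then show ?case
        using Suc by simp
    qed (simp add: s_def)
    from this[of "Suc N"] show "cech_map A B f i h \<V> = cech_map A B g i h \<V>"
      by (simp add: s_def H01 del: of_nat_Suc)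
  qed (simp_all add: cech_map_def)
qed


section \<open>Dimensions of images\<close>

text \<open>Sets independent in the subspace are independent in \<open>V\<close>, so
  \<open>dim\<close> bounds their size and a maximal one is a finite basis. For infinite-dimensional
  \<open>V\<close> the bound is \<open>\<infinity>\<close>.\<close>

lemma edim_subspace_le:
  fixes K :: "'k ring"
  assumes "subspace K N V"
  shows "edim (V\<lparr>carrier := N\<rparr>) K \<le> edim V K"
proof (cases "vectorspace.fin_dim K V")
  case True
  interpret vectorspace K V
    using assms by (simp add: subspace_def)
  interpret N: vectorspace K "vs N"
    using assms by (rule subspace_is_vs)
  have sub: "submodule K N V"
    using assms by (simp add: subspace_def)
  then have "N \<subseteq> carrier V"
    by (simp add: submodule_def)
  have bound: "finite A \<and> card A \<le> dim" if "A \<subseteq> carrier (vs N) \<and> N.lin_indpt A" for A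
    using that True \<open>N \<subseteq> carrier V\<close> span_li_not_depend(2)[OF _ sub, of A]
    by (auto intro!: li_le_dim)
  moreover have "{} \<subseteq> carrier (vs N) \<and> N.lin_indpt {}"
    by (simp add: N.lin_dep_def)
  ultimately obtain A where A: "finite A" "maximal A (\<lambda>S. S \<subseteq> carrier (vs N) \<and> N.lin_indpt S)"
    using maximal_exists[of "\<lambda>S. S \<subseteq> carrier (vs N) \<and> N.lin_indpt S" dim "{}"] by blast
  then have "N.basis A"
    by (intro N.max_li_is_basis)
  then have "N.fin_dim" "N.dim = card A"
    using A(1) N.dim_basis[of A] by (auto simp: N.fin_dim_def N.basis_def)
  moreover have "card A \<le> dim"
    using A bound by (simp add: maximal_def)
  ultimately show ?thesis
    using True by (simp add: edim_def)
qed (simp add: edim_def)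

text \<open>Rank-nullity for finite-dimensional \<open>V\<close>; otherwise the right side is
  \<open>\<infinity>\<close>. Finite dimension of the image comes from regarding \<open>T\<close> as
  a map onto it.\<close>

lemma edim_image_le:
  fixes K :: "'k ring"
  assumes "linear_map K V W T"
  shows "edim (W\<lparr>carrier := T ` carrier V\<rparr>) K \<le> edim V K"
proof (cases "vectorspace.fin_dim K V")
  case True
  interpret linear_map K V W T
    by (rule assms)
  have "vectorspace K (W.vs imT)"
    by (rule W.subspace_is_vs[OF imT_is_subspace])
  then interpret im: vectorspace K "W\<lparr>carrier := T ` carrier V\<rparr>"
    by (simp add: im_def)
  have hom: "T \<in> module_hom K V (W\<lparr>carrier := T ` carrier V\<rparr>)"
    by (simp add: module_hom_def)
  interpret T: linear_map K V "W\<lparr>carrier := T ` carrier V\<rparr>" T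
    by unfold_locales (rule hom)
  have "im.fin_dim"
    using T.rank_nullity_main(2)[OF True] by simp
  moreover have "im.dim \<le> V.dim"
    using rank_nullity_main(1)[OF True] by (simp add: im_def)
  ultimately show ?thesis
    using True by (simp add: edim_def)
qed (simp add: edim_def)

section \<open>Vector space structures on simplicial and Cech homology\<close>

lemma field_field_ring: "field (field_ring :: 'k::field ring)"
proof -
  have "cring (field_ring :: 'k ring)"
  proof (rule cringI)
    show "abelian_group (field_ring :: 'k ring)"
    proof (rule abelian_groupI)
      fix x :: 'k
      show "\<exists>y\<in>carrier field_ring. y \<oplus>\<^bsub>field_ring\<^esub> x = \<zero>\<^bsub>field_ring\<^esub>"
        by (rule bexI[of _ "- x"]) simp_all
    qed (auto simp: algebra_simps)
    show "Group.comm_monoid (field_ring :: 'k ring)"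
      by (rule comm_monoidI) (auto simp: algebra_simps)
  qed (auto simp: algebra_simps)
  moreover have "\<exists>y. x * y = 1 \<and> y * x = 1" if "x \<noteq> 0" for x :: 'k
    using that by (intro exI[of _ "inverse x"]) simp
  then have "Units (field_ring :: 'k ring) = carrier field_ring - {\<zero>\<^bsub>field_ring\<^esub>}"
    by (auto simp: Units_def)
  ultimately show ?thesis
    by (rule cring.cring_fieldI)
qed

lemma vectorspace_simplicial_homology:
  "vectorspace field_ring (simplicial_homology X i :: ('k::field, ('v list \<Rightarrow> 'k) set) module)"
proof (rule vs_criteria)
  let ?H = "simplicial_homology X i :: ('k, ('v list \<Rightarrow> 'k) set) module"
  note simps = carrier_simplicial_homology simplicial_homology_add simplicial_homology_smult
    simplicial_homology_zero
  show "field (field_ring :: 'k ring)"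
    by (rule field_field_ring)
  show "\<forall>v\<in>carrier ?H. \<exists>neg_v\<in>carrier ?H. v \<oplus>\<^bsub>?H\<^esub> neg_v = \<zero>\<^bsub>?H\<^esub>"
  proof
    fix v assume "v \<in> carrier ?H"
    then obtain z where "z \<in> cycles X i" "v = hom_class X i z"
      by (auto simp: simps)
    then show "\<exists>neg_v\<in>carrier ?H. v \<oplus>\<^bsub>?H\<^esub> neg_v = \<zero>\<^bsub>?H\<^esub>"
      using cycles_mult[of z X i "-1"]
      by (intro bexI[of _ "hom_class X i (\<lambda>s. -1 * z s)"]) (auto simp: simps)
  qed
qed (auto simp: carrier_simplicial_homology simplicial_homology_add simplicial_homology_smult
    simplicial_homology_zero algebra_simps intro!: imageI zero_cycles cycles_add cycles_mult)

lemma nerve_map_closed: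
  assumes "finite \<W>" "finite \<V>" "cover_map g \<W> \<V> p"
    "A \<in> carrier (simplicial_homology (nerve \<W>) i)"
  shows "nerve_map g i \<W> \<V> A \<in> carrier (simplicial_homology (nerve \<V>) i)"
  using assms unfolding nerve_map_eq[OF assms]
  by (intro induced_hom_closed finite_complex_nerve cover_map_simplicial_map)

lemma nerve_map_add:
  assumes "finite \<W>" "finite \<V>" "cover_map g \<W> \<V> p"
    "A \<in> carrier (simplicial_homology (nerve \<W>) i)" "B \<in> carrier (simplicial_homology (nerve \<W>) i)"
  shows "nerve_map g i \<W> \<V> (A \<oplus>\<^bsub>simplicial_homology (nerve \<W>) i\<^esub> B)
    = nerve_map g i \<W> \<V> A \<oplus>\<^bsub>simplicial_homology (nerve \<V>) i\<^esub> nerve_map g i \<W> \<V> B"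
proof -
  interpret vectorspace field_ring "simplicial_homology (nerve \<W>) i"
    by (rule vectorspace_simplicial_homology)
  show ?thesis
    using assms by (simp add: nerve_map_eq[OF assms(1-3)] induced_hom_add finite_complex_nerve
        cover_map_simplicial_map[OF assms(3)])
qed

lemma nerve_map_smult:
  assumes "finite \<W>" "finite \<V>" "cover_map g \<W> \<V> p"
    "A \<in> carrier (simplicial_homology (nerve \<W>) i)"
  shows "nerve_map g i \<W> \<V> (r \<odot>\<^bsub>simplicial_homology (nerve \<W>) i\<^esub> A)
    = r \<odot>\<^bsub>simplicial_homology (nerve \<V>) i\<^esub> nerve_map g i \<W> \<V> A"
proof -
  interpret vectorspace field_ring "simplicial_homology (nerve \<W>) i"
    by (rule vectorspace_simplicial_homology)
  have "r \<odot>\<^bsub>simplicial_homology (nerve \<W>) i\<^esub> A \<in> carrier (simplicial_homology (nerve \<W>) i)"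
    using assms(4) smult_closed[of r A] by simp
  then show ?thesis
    using assms by (simp add: nerve_map_eq[OF assms(1-3)] induced_hom_smult finite_complex_nerve
        cover_map_simplicial_map[OF assms(3)])
qed

lemma cech_homology_carrierI:
  assumes "h \<in> extensional (finite_open_covers Z)"
    and "\<And>\<U>. \<U> \<in> finite_open_covers Z \<Longrightarrow> h \<U> \<in> carrier (simplicial_homology (nerve \<U>) i)"
    and "\<And>\<W> \<V> p. \<W> \<in> finite_open_covers Z \<Longrightarrow> \<V> \<in> finite_open_covers Z \<Longrightarrow>
      cover_map (\<lambda>x. x) \<W> \<V> p \<Longrightarrow> nerve_map (\<lambda>x. x) i \<W> \<V> (h \<W>) = h \<V>"
  shows "h \<in> carrier (cech_homology Z i)"
proof -
  have "\<exists>p. cover_map (\<lambda>x. x) \<W> \<V> p" if "refines \<W> \<V>" for \<W> \<V> :: "'a set set"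
    using cover_map_exists[of \<W> \<V> "\<lambda>x. x"] that unfolding refines_def by (metis image_ident)
  then have "nerve_hom i \<W> \<V> (h \<W>) = h \<V>"
    if "\<W> \<in> finite_open_covers Z" "\<V> \<in> finite_open_covers Z" "refines \<W> \<V>" for \<W> \<V>
    unfolding nerve_hom_eq_nerve_map using assms(3)[OF that(1,2)] that(3) by blast
  then show ?thesis
    using assms(1,2) by (simp add: cech_homology_def PiE_iff)
qed

lemma cech_homology_nerve_map:
  assumes "h \<in> carrier (cech_homology Z i)" "\<W> \<in> finite_open_covers Z" "\<V> \<in> finite_open_covers Z"
    and "cover_map (\<lambda>x. x) \<W> \<V> p"
  shows "nerve_map (\<lambda>x. x) i \<W> \<V> (h \<W>) = h \<V>"
  using nerve_map_eq[OF _ _ assms(4) cech_homology_component[OF assms(1,2)]]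
    cech_homology_compatible[OF assms] assms(2,3)
  by (simp add: finite_open_coversD(1))

text \<open>All axioms are inherited componentwise from the homology of the nerves; that sums and
  multiples stay compatible under refinement is the linearity of \<open>nerve_map\<close>.\<close>

lemma vectorspace_cech_homology:
  "vectorspace field_ring (cech_homology Z i :: ('k::field, 'a::topological_space set set \<Rightarrow> ('a set list \<Rightarrow> 'k) set) module)"
proof -
  let ?C = "cech_homology Z i :: ('k, 'a set set \<Rightarrow> ('a set list \<Rightarrow> 'k) set) module"
  let ?O = "finite_open_covers Z"
  let ?H = "\<lambda>\<U>. simplicial_homology (nerve \<U>) i :: ('k, ('a set list \<Rightarrow> 'k) set) module"
  interpret H: vectorspace field_ring "?H \<U>" for \<U>
    by (rule vectorspace_simplicial_homology)
  note comp = cech_homology_component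
  have ext: "g = h" if "g \<in> carrier ?C" "h \<in> carrier ?C" "\<And>\<U>. \<U> \<in> ?O \<Longrightarrow> g \<U> = h \<U>" for g h
    using that by (auto simp: cech_homology_def intro: PiE_ext)
  have add_apply: "(g \<oplus>\<^bsub>?C\<^esub> h) \<U> = g \<U> \<oplus>\<^bsub>?H \<U>\<^esub> h \<U>" if "\<U> \<in> ?O" for g h \<U>
    using that by (simp add: cech_homology_def)
  have smult_apply: "(r \<odot>\<^bsub>?C\<^esub> h) \<U> = r \<odot>\<^bsub>?H \<U>\<^esub> h \<U>" if "\<U> \<in> ?O" for r h \<U>
    using that by (simp add: cech_homology_def)
  have zero_apply: "\<zero>\<^bsub>?C\<^esub> \<U> = \<zero>\<^bsub>?H \<U>\<^esub>" if "\<U> \<in> ?O" for \<U>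
    using that by (simp add: cech_homology_def)
  have add_closed: "g \<oplus>\<^bsub>?C\<^esub> h \<in> carrier ?C" if gh: "g \<in> carrier ?C" "h \<in> carrier ?C" for g h
  proof (rule cech_homology_carrierI)
    show "g \<oplus>\<^bsub>?C\<^esub> h \<in> extensional ?O"
      by (simp add: cech_homology_def)
    show "(g \<oplus>\<^bsub>?C\<^esub> h) \<U> \<in> carrier (?H \<U>)" if "\<U> \<in> ?O" for \<U>
      using comp[OF gh(1) that] comp[OF gh(2) that] by (simp add: add_apply that)
    show "nerve_map (\<lambda>x. x) i \<W> \<V> ((g \<oplus>\<^bsub>?C\<^esub> h) \<W>) = (g \<oplus>\<^bsub>?C\<^esub> h) \<V>"
      if "\<W> \<in> ?O" "\<V> \<in> ?O" "cover_map (\<lambda>x. x) \<W> \<V> p" for \<W> \<V> p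
      using nerve_map_add[OF _ _ that(3) comp[OF gh(1) that(1)] comp[OF gh(2) that(1)]]
        cech_homology_nerve_map[OF gh(1) that] cech_homology_nerve_map[OF gh(2) that] that(1,2)
      by (simp add: add_apply finite_open_coversD(1))
  qed
  have smult_closed: "r \<odot>\<^bsub>?C\<^esub> h \<in> carrier ?C" if h: "h \<in> carrier ?C" for r h
  proof (rule cech_homology_carrierI)
    show "r \<odot>\<^bsub>?C\<^esub> h \<in> extensional ?O"
      by (simp add: cech_homology_def)
    show "(r \<odot>\<^bsub>?C\<^esub> h) \<U> \<in> carrier (?H \<U>)" if "\<U> \<in> ?O" for \<U>
      using comp[OF h that] H.smult_closed[of r] by (simp add: smult_apply that)
    show "nerve_map (\<lambda>x. x) i \<W> \<V> ((r \<odot>\<^bsub>?C\<^esub> h) \<W>) = (r \<odot>\<^bsub>?C\<^esub> h) \<V>"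
      if "\<W> \<in> ?O" "\<V> \<in> ?O" "cover_map (\<lambda>x. x) \<W> \<V> p" for \<W> \<V> p
      using nerve_map_smult[OF _ _ that(3) comp[OF h that(1)]]
        cech_homology_nerve_map[OF h that] that(1,2)
      by (simp add: smult_apply finite_open_coversD(1))
  qed
  have zero_closed: "\<zero>\<^bsub>?C\<^esub> \<in> carrier ?C"
  proof (rule cech_homology_carrierI)
    show "\<zero>\<^bsub>?C\<^esub> \<in> extensional ?O"
      by (simp add: cech_homology_def)
    show "\<zero>\<^bsub>?C\<^esub> \<U> \<in> carrier (?H \<U>)" if "\<U> \<in> ?O" for \<U>
      by (simp add: zero_apply that)
    show "nerve_map (\<lambda>x. x) i \<W> \<V> (\<zero>\<^bsub>?C\<^esub> \<W>) = \<zero>\<^bsub>?C\<^esub> \<V>"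
      if "\<W> \<in> ?O" "\<V> \<in> ?O" "cover_map (\<lambda>x. x) \<W> \<V> p" for \<W> \<V> p
    proof -
      \<comment> \<open>Zero is written as a multiple by the scalar \<open>0\<close>, which
        \<open>nerve_map\<close> preserves.\<close>
      have "nerve_map (\<lambda>x. x) i \<W> \<V> (0 \<odot>\<^bsub>?H \<W>\<^esub> \<zero>\<^bsub>?H \<W>\<^esub>) = 0 \<odot>\<^bsub>?H \<V>\<^esub> nerve_map (\<lambda>x. x) i \<W> \<V> \<zero>\<^bsub>?H \<W>\<^esub>"
        using that by (intro nerve_map_smult[where p = p]) (auto simp: finite_open_coversD(1))
      moreover have "nerve_map (\<lambda>x. x) i \<W> \<V> \<zero>\<^bsub>?H \<W>\<^esub> \<in> carrier (?H \<V>)"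
        using that by (intro nerve_map_closed[where p = p]) (auto simp: finite_open_coversD(1))
      ultimately show ?thesis
        using H.lmult_0 by (simp add: zero_apply that)
    qed
  qed
  note closed = add_closed smult_closed zero_closed
  show ?thesis
  proof (rule vs_criteria)
    show "field (field_ring :: 'k ring)"
      by (rule field_field_ring)
    show "\<forall>v\<in>carrier ?C. \<exists>neg_v\<in>carrier ?C. v \<oplus>\<^bsub>?C\<^esub> neg_v = \<zero>\<^bsub>?C\<^esub>"
    proof
      fix v assume v: "v \<in> carrier ?C"
      have "v \<oplus>\<^bsub>?C\<^esub> (-1 \<odot>\<^bsub>?C\<^esub> v) = \<zero>\<^bsub>?C\<^esub>"
      proof (rule ext)
        fix \<U> assume "\<U> \<in> ?O"
        then show "(v \<oplus>\<^bsub>?C\<^esub> (-1 \<odot>\<^bsub>?C\<^esub> v)) \<U> = \<zero>\<^bsub>?C\<^esub> \<U>"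
          using H.smult_l_distr[of 1 "-1" "v \<U>" \<U>] H.smult_one[of "v \<U>" \<U>] H.lmult_0[of "v \<U>" \<U>] comp[OF v]
          by (simp add: add_apply smult_apply zero_apply)
      qed (use v in \<open>auto intro!: closed\<close>)
      then show "\<exists>neg_v\<in>carrier ?C. v \<oplus>\<^bsub>?C\<^esub> neg_v = \<zero>\<^bsub>?C\<^esub>"
        using smult_closed[OF v] by blast
    qed
    show "\<forall>v w. v \<in> carrier ?C \<and> w \<in> carrier ?C \<longrightarrow> v \<oplus>\<^bsub>?C\<^esub> w = w \<oplus>\<^bsub>?C\<^esub> v"
      by (auto intro!: ext closed simp: add_apply comp H.M.a_comm)
    show "\<forall>v w x. v \<in> carrier ?C \<and> w \<in> carrier ?C \<and> x \<in> carrier ?C \<longrightarrow>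
        v \<oplus>\<^bsub>?C\<^esub> w \<oplus>\<^bsub>?C\<^esub> x = v \<oplus>\<^bsub>?C\<^esub> (w \<oplus>\<^bsub>?C\<^esub> x)"
      by (auto intro!: ext closed simp: add_apply comp H.M.a_assoc)
    show "\<forall>v\<in>carrier ?C. v \<oplus>\<^bsub>?C\<^esub> \<zero>\<^bsub>?C\<^esub> = v"
      by (auto intro!: ext closed simp: add_apply zero_apply comp)
    show "\<forall>a b v. a \<in> carrier field_ring \<and> b \<in> carrier field_ring \<and> v \<in> carrier ?C \<longrightarrow>
        (a \<otimes>\<^bsub>field_ring\<^esub> b) \<odot>\<^bsub>?C\<^esub> v = a \<odot>\<^bsub>?C\<^esub> (b \<odot>\<^bsub>?C\<^esub> v)"
      using H.smult_assoc1 by (auto intro!: ext closed simp: smult_apply comp)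
    show "\<forall>v\<in>carrier ?C. \<one>\<^bsub>field_ring\<^esub> \<odot>\<^bsub>?C\<^esub> v = v"
      using H.smult_one by (auto intro!: ext closed simp: smult_apply comp)
    show "\<forall>a b v. a \<in> carrier field_ring \<and> b \<in> carrier field_ring \<and> v \<in> carrier ?C \<longrightarrow>
        (a \<oplus>\<^bsub>field_ring\<^esub> b) \<odot>\<^bsub>?C\<^esub> v = a \<odot>\<^bsub>?C\<^esub> v \<oplus>\<^bsub>?C\<^esub> b \<odot>\<^bsub>?C\<^esub> v"
      using H.smult_l_distr by (auto intro!: ext closed simp: add_apply smult_apply comp)
    show "\<forall>a v w. a \<in> carrier field_ring \<and> v \<in> carrier ?C \<and> w \<in> carrier ?C \<longrightarrow>
        a \<odot>\<^bsub>?C\<^esub> (v \<oplus>\<^bsub>?C\<^esub> w) = a \<odot>\<^bsub>?C\<^esub> v \<oplus>\<^bsub>?C\<^esub> a \<odot>\<^bsub>?C\<^esub> w"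
      using H.smult_r_distr by (auto intro!: ext closed simp: add_apply smult_apply comp)
  qed (use closed in auto)
qed

lemma linear_map_cech_map:
  fixes A :: "'a::topological_space set" and B :: "'b::topological_space set"
  assumes g: "continuous_on A g" "g ` A \<subseteq> B"
  shows "linear_map field_ring (cech_homology A i :: ('k::field, _) module) (cech_homology B i) (cech_map A B g i)"
proof -
  let ?CA = "cech_homology A i :: ('k, 'a set set \<Rightarrow> ('a set list \<Rightarrow> 'k) set) module"
  let ?CB = "cech_homology B i :: ('k, 'b set set \<Rightarrow> ('b set list \<Rightarrow> 'k) set) module"
  interpret A: vectorspace field_ring ?CA
    by (rule vectorspace_cech_homology)
  interpret B: vectorspace field_ring ?CB
    by (rule vectorspace_cech_homology)
  have "cech_map A B g i (h \<oplus>\<^bsub>?CA\<^esub> h') = cech_map A B g i h \<oplus>\<^bsub>?CB\<^esub> cech_map A B g i h'"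
    if h: "h \<in> carrier ?CA" and h': "h' \<in> carrier ?CA" for h h'
  proof (rule extensionalityI[of _ "finite_open_covers B"])
    fix \<V> assume \<V>: "\<V> \<in> finite_open_covers B"
    note pre = preimage_cover_finite_open_covers[OF g \<V>]
    obtain p where p: "cover_map g (preimage_cover A g \<V>) \<V> p"
      by (rule preimage_cover_cover_map)
    show "cech_map A B g i (h \<oplus>\<^bsub>?CA\<^esub> h') \<V> = (cech_map A B g i h \<oplus>\<^bsub>?CB\<^esub> cech_map A B g i h') \<V>"
      using nerve_map_add[OF _ _ p cech_homology_component[OF h pre] cech_homology_component[OF h' pre]]
        finite_open_coversD(1)[OF pre] finite_open_coversD(1)[OF \<V>] pre \<V>
      by (simp add: cech_map_def) (simp add: cech_homology_def)
  qed (simp_all add: cech_map_def cech_homology_def)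
  moreover have "cech_map A B g i (r \<odot>\<^bsub>?CA\<^esub> h) = r \<odot>\<^bsub>?CB\<^esub> cech_map A B g i h"
    if h: "h \<in> carrier ?CA" for r h
  proof (rule extensionalityI[of _ "finite_open_covers B"])
    fix \<V> assume \<V>: "\<V> \<in> finite_open_covers B"
    note pre = preimage_cover_finite_open_covers[OF g \<V>]
    obtain p where p: "cover_map g (preimage_cover A g \<V>) \<V> p"
      by (rule preimage_cover_cover_map)
    show "cech_map A B g i (r \<odot>\<^bsub>?CA\<^esub> h) \<V> = (r \<odot>\<^bsub>?CB\<^esub> cech_map A B g i h) \<V>"
      using nerve_map_smult[OF _ _ p cech_homology_component[OF h pre]]
        finite_open_coversD(1)[OF pre] finite_open_coversD(1)[OF \<V>] pre \<V>
      by (simp add: cech_map_def) (simp add: cech_homology_def)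
  qed (simp_all add: cech_map_def cech_homology_def)
  ultimately have "cech_map A B g i \<in> module_hom field_ring ?CA ?CB"
    using cech_map_closed[OF _ g] by (auto simp: module_hom_def)
  then show ?thesis
    by unfold_locales
qed

text \<open>The map from \<open>A\<close> to \<open>B\<close> factors through the one from
  \<open>A'\<close> to \<open>B'\<close>, so its image \<open>?I\<close> lies in \<open>?J\<close>,
  the image of \<open>?I'\<close> under a linear map. Passing to a subspace or to a linear image
  does not raise the dimension.\<close>

lemma edim_cech_image_le:
  fixes A A' :: "'a::topological_space set" and B B' :: "'a set"
  assumes "A \<subseteq> B" "A' \<subseteq> B'"
    and g: "continuous_on A g" "g ` A \<subseteq> A'" and g': "continuous_on B' g'" "g' ` B' \<subseteq> B"
    and factor: "\<And>h :: 'a set set \<Rightarrow> ('a set list \<Rightarrow> 'k) set. h \<in> carrier (cech_homology A i) \<Longrightarrow>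
      cech_inclusion A B i h = cech_map B' B g' i (cech_inclusion A' B' i (cech_map A A' g i h))"
  shows "edim ((cech_homology B i :: ('k::field, _) module)
      \<lparr>carrier := cech_inclusion A B i ` carrier (cech_homology A i)\<rparr>) field_ring
    \<le> edim ((cech_homology B' i :: ('k, _) module)
      \<lparr>carrier := cech_inclusion A' B' i ` carrier (cech_homology A' i)\<rparr>) field_ring"
proof -
  let ?C = "\<lambda>Z. cech_homology Z i :: ('k, 'a set set \<Rightarrow> ('a set list \<Rightarrow> 'k) set) module"
  let ?I = "cech_inclusion A B i ` carrier (?C A)"
  let ?I' = "cech_inclusion A' B' i ` carrier (?C A')"
  have id: "continuous_on Z (\<lambda>x. x)" "A \<subseteq> B \<Longrightarrow> (\<lambda>x. x) ` A \<subseteq> B" for Z A B :: "'a set"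
    by auto
  interpret in': linear_map field_ring "?C A'" "?C B'" "cech_inclusion A' B' i"
    unfolding cech_inclusion_eq_cech_map using assms(2) by (intro linear_map_cech_map id)
  interpret "in": linear_map field_ring "?C A" "?C B" "cech_inclusion A B i"
    unfolding cech_inclusion_eq_cech_map using assms(1) by (intro linear_map_cech_map id)
  interpret g': linear_map field_ring "?C B'" "?C B" "cech_map B' B g' i"
    by (intro linear_map_cech_map g')
  have "subspace field_ring ?I' (?C B')"
    using in'.imT_is_subspace by (simp add: in'.im_def)
  then have vs': "vectorspace field_ring (?C B'\<lparr>carrier := ?I'\<rparr>)" and "?I' \<subseteq> carrier (?C B')"
    by (auto intro: in'.W.subspace_is_vs simp: subspace_def submodule_def)
  then have hom: "cech_map B' B g' i \<in> module_hom field_ring (?C B'\<lparr>carrier := ?I'\<rparr>) (?C B)"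
    using g'.f_hom by (auto simp: module_hom_def subset_iff)
  interpret I': vectorspace field_ring "?C B'\<lparr>carrier := ?I'\<rparr>"
    by (rule vs')
  interpret r: linear_map field_ring "?C B'\<lparr>carrier := ?I'\<rparr>" "?C B" "cech_map B' B g' i"
    by unfold_locales (rule hom)
  let ?J = "cech_map B' B g' i ` ?I'"
  have J: "subspace field_ring ?J (?C B)"
    using r.imT_is_subspace by (simp add: r.im_def)
  interpret J: vectorspace field_ring "?C B\<lparr>carrier := ?J\<rparr>"
    by (rule in.W.subspace_is_vs[OF J])
  have "?I \<subseteq> ?J"
  proof
    fix x assume "x \<in> ?I"
    then obtain h where "h \<in> carrier (?C A)" "x = cech_inclusion A B i h"
      by blast
    then show "x \<in> ?J"
      using factor cech_map_closed[OF _ g] by blast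
  qed
  have "subspace field_ring ?I (?C B)"
    using in.imT_is_subspace by (simp add: in.im_def)
  then have "subspace field_ring ?I (?C B\<lparr>carrier := ?J\<rparr>)"
    using \<open>?I \<subseteq> ?J\<close> J.vectorspace_axioms J.module_axioms
    by (auto simp: subspace_def submodule_def)
  from edim_subspace_le[OF this]
  have "edim (?C B\<lparr>carrier := ?I\<rparr>) field_ring \<le> edim (?C B\<lparr>carrier := ?J\<rparr>) field_ring"
    by simp
  also have "\<dots> \<le> edim (?C B'\<lparr>carrier := ?I'\<rparr>) field_ring"
    using edim_image_le[OF r.linear_map_axioms] by simp
  finally show ?thesis .
qed


section \<open>The mixed Voronoi-Delaunay interpolation\<close>

text \<open>The lower faces of this polytope project to the Delaunay cells of \<open>L\<close>.\<close>

definition lifted_hull :: "'a::euclidean_space set \<Rightarrow> ('a \<times> real) set" where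
  "lifted_hull L = convex hull ((\<lambda>l. (l, l \<bullet> l)) ` L)"

lemma compact_lifted_hull: "finite L \<Longrightarrow> compact (lifted_hull L)"
  unfolding lifted_hull_def by (intro compact_convex_hull finite_imp_compact) simp

lemma convex_lifted_hull: "convex (lifted_hull L)"
  by (simp add: lifted_hull_def)

lemma lifted_hull_mono: "T \<subseteq> L \<Longrightarrow> lifted_hull T \<subseteq> lifted_hull L"
  unfolding lifted_hull_def by (intro hull_mono image_mono)

lemma vertex_lifted_hull: "l \<in> L \<Longrightarrow> (l, l \<bullet> l) \<in> lifted_hull L"
  unfolding lifted_hull_def by (intro hull_inc) simp

lemma fst_lifted_hull: "fst ` lifted_hull L = convex hull L"
proof -
  have "fst ` lifted_hull L = convex hull (fst ` (\<lambda>l. (l, l \<bullet> l)) ` L)"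
    unfolding lifted_hull_def by (rule convex_hull_linear_image[OF linear_fst])
  then show ?thesis
    by (simp add: image_image)
qed

text \<open>A linear inequality valid at the vertices describes a half-space, and this contains the
  hull.\<close>

lemma lifted_hull_ge:
  assumes "(x, a) \<in> lifted_hull L" "\<And>l. l \<in> L \<Longrightarrow> c \<le> w \<bullet> l + \<alpha> * (l \<bullet> l)"
  shows "c \<le> w \<bullet> x + \<alpha> * a"
proof -
  have "lifted_hull L \<subseteq> {z. (w, \<alpha>) \<bullet> z \<ge> c}"
    unfolding lifted_hull_def
    by (rule hull_minimal) (use assms(2) in \<open>auto intro: convex_halfspace_ge simp: inner_Pair\<close>)
  then show ?thesis
    using assms(1) by (auto simp: inner_Pair)
qed

text \<open>For weights that represent \<open>(x, a)\<close>, the expression in \<open>a\<close> and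
  \<open>x\<close> is the weighted average of the squared distances from \<open>q\<close> to the
  points of \<open>L\<close>.\<close>

lemma lifted_hull_sqdist_ge:
  assumes "(x, a) \<in> lifted_hull L" "\<And>l. l \<in> L \<Longrightarrow> c \<le> (l - q) \<bullet> (l - q)"
  shows "c \<le> a - 2 * (q \<bullet> x) + q \<bullet> q"
  using lifted_hull_ge[OF assms(1), of "c - q \<bullet> q" "- 2 *\<^sub>R q" 1] assms(2)
  by (simp add: inner_diff_left inner_diff_right inner_commute algebra_simps)

lemma lifted_hull_sqdist_le:
  assumes "(x, a) \<in> lifted_hull L" "\<And>l. l \<in> L \<Longrightarrow> (l - q) \<bullet> (l - q) \<le> c"
  shows "a - 2 * (q \<bullet> x) + q \<bullet> q \<le> c"
  using lifted_hull_ge[OF assms(1), of "q \<bullet> q - c" "2 *\<^sub>R q" "- 1"] assms(2)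
  by (simp add: inner_diff_left inner_diff_right inner_commute algebra_simps)

lemma lifted_hull_weights:
  assumes "finite L" "(x, a) \<in> lifted_hull L"
  obtains \<mu> where "\<And>l. l \<in> L \<Longrightarrow> 0 \<le> \<mu> l" "sum \<mu> L = 1"
    "(\<Sum>l\<in>L. \<mu> l *\<^sub>R l) = x" "(\<Sum>l\<in>L. \<mu> l * (l \<bullet> l)) = a"
proof -
  let ?f = "\<lambda>l::'a. (l, l \<bullet> l)"
  have inj: "inj_on ?f L"
    by (auto intro: inj_onI)
  obtain u where u: "\<forall>z\<in>?f ` L. 0 \<le> u z" "sum u (?f ` L) = 1" "(\<Sum>z\<in>?f ` L. u z *\<^sub>R z) = (x, a)"
    using assms by (auto simp: lifted_hull_def convex_hull_finite)
  have "(\<Sum>l\<in>L. u (?f l) *\<^sub>R ?f l) = (x, a)"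
    using u(3) by (simp add: sum.reindex[OF inj])
  then have "(\<Sum>l\<in>L. u (?f l) *\<^sub>R l) = x" "(\<Sum>l\<in>L. u (?f l) * (l \<bullet> l)) = a"
    by (simp_all add: prod_eq_iff fst_sum snd_sum)
  moreover have "sum (u \<circ> ?f) L = 1"
    using u(2) by (simp add: sum.reindex[OF inj])
  ultimately show thesis
    using u(1) by (intro that[of "u \<circ> ?f"]) auto
qed

text \<open>The variational inequality for the minimisers over the lifted hull of the convex function
  \<open>(x, a) \<mapsto> t (a - 2 (p \<bullet> x) + p \<bullet> p) + (1 - t) |x - p|\<^sup>2\<close>; on a convex combination \<open>x\<close> of points \<open>l\<close>
  and the corresponding \<open>a\<close>, the first summand is the average of \<open>t |l - p|\<^sup>2\<close>. At \<open>t = 0\<close> the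
  minimiser is the nearest point of the convex hull; as \<open>t\<close> tends to \<open>1\<close>, only vertices almost
  nearest to \<open>p\<close> keep a positive weight.\<close>

definition mixed_point :: "'a::euclidean_space set \<Rightarrow> real \<Rightarrow> 'a \<Rightarrow> 'a \<Rightarrow> real \<Rightarrow> bool" where
  "mixed_point L t p x a \<longleftrightarrow> (x, a) \<in> lifted_hull L \<and>
     (\<forall>(x', a')\<in>lifted_hull L.
        0 \<le> t * (a' - a - 2 * (p \<bullet> (x' - x))) + 2 * (1 - t) * ((x - p) \<bullet> (x' - x)))"

lemma mixed_pointD:
  assumes "mixed_point L t p x a" "(x', a') \<in> lifted_hull L"
  shows "0 \<le> t * (a' - a - 2 * (p \<bullet> (x' - x))) + 2 * (1 - t) * ((x - p) \<bullet> (x' - x))"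
  using assms by (auto simp: mixed_point_def)

section \<open>Existence and continuous dependence of mixed points\<close>

lemma mixed_point_exists:
  assumes "finite L" "L \<noteq> {}" "t \<le> 1"
  obtains x a where "mixed_point L t p x a"
proof -
  \<comment> \<open>The convex function to be minimised, up to the constant
    \<open>t * (p \<bullet> p)\<close>.\<close>
  define F where "F z = t * (snd z - 2 * (p \<bullet> fst z)) + (1 - t) * ((fst z - p) \<bullet> (fst z - p))" for z :: "'a \<times> real"
  have "continuous_on (lifted_hull L) F"
    unfolding F_def by (intro continuous_intros)
  moreover have "lifted_hull L \<noteq> {}"
    using assms(2) vertex_lifted_hull by fastforce
  ultimately obtain z where z: "z \<in> lifted_hull L" "\<And>z'. z' \<in> lifted_hull L \<Longrightarrow> F z \<le> F z'"
    using continuous_attains_inf[OF compact_lifted_hull[OF assms(1)]] by blast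
  obtain x a where xa: "z = (x, a)"
    by (cases z)
  have "0 \<le> t * (a' - a - 2 * (p \<bullet> (x' - x))) + 2 * (1 - t) * ((x - p) \<bullet> (x' - x))"
    if z': "(x', a') \<in> lifted_hull L" for x' a'
  proof -
    \<comment> \<open>On the segment towards \<open>(x', a')\<close>, \<open>F\<close> is a
      quadratic polynomial in the parameter \<open>e\<close> with linear coefficient
      \<open>D\<close> and leading coefficient \<open>E\<close>.\<close>
    define D where "D = t * (a' - a - 2 * (p \<bullet> (x' - x))) + 2 * (1 - t) * ((x - p) \<bullet> (x' - x))"
    define E where "E = (1 - t) * ((x' - x) \<bullet> (x' - x))"
    have "0 \<le> E"
      using assms(3) by (simp add: E_def)
    have pos: "0 \<le> D + e * E" if e: "0 < e" "e \<le> 1" for e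
    proof -
      have "(1 - e) *\<^sub>R (x, a) + e *\<^sub>R (x', a') \<in> lifted_hull L"
        using z(1) z' xa e by (intro convexD[OF convex_lifted_hull]) auto
      then have "F (x, a) \<le> F ((1 - e) *\<^sub>R (x, a) + e *\<^sub>R (x', a'))"
        using z(2) xa by blast
      also have "\<dots> = F (x, a) + e * (D + e * E)"
        unfolding F_def D_def E_def
        by (simp add: inner_diff_left inner_diff_right inner_add_left inner_add_right inner_commute algebra_simps)
      finally have "0 \<le> e * (D + e * E)"
        by simp
      then show ?thesis
        using e(1) by (simp add: zero_le_mult_iff)
    qed
    show "0 \<le> D"
    proof (rule ccontr)
      assume "\<not> 0 \<le> D"
      then have "D < 0"
        by simp
      \<comment> \<open>Small enough for \<open>e * E\<close> to be at most \<open>- D / 2\<close>;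
        adding \<open>1\<close> to \<open>E\<close> avoids a division by zero.\<close>
      define e where "e = min 1 (- D / (2 * (E + 1)))"
      have e: "0 < e" "e \<le> 1"
        using \<open>D < 0\<close> \<open>0 \<le> E\<close> by (auto simp: e_def divide_neg_pos)
      have "e * E \<le> (- D / (2 * (E + 1))) * (E + 1)"
        using e \<open>0 \<le> E\<close> \<open>D < 0\<close> by (intro mult_mono) (auto simp: e_def divide_nonpos_pos)
      also have "\<dots> = - D / 2"
        using \<open>0 \<le> E\<close> by (simp add: field_simps)
      finally show False
        using pos[OF e] \<open>D < 0\<close> by simp
    qed
  qed
  then have "mixed_point L t p x a"
    using z(1) xa by (auto simp: mixed_point_def)
  then show thesis
    by (rule that)
qed

text \<open>Each variational inequality is tested at the other mixed point and the two are added.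
  For \<open>t' = t\<close> and \<open>p' = p\<close> the right side vanishes, so \<open>x\<close>
  is unique when \<open>t < 1\<close>; in general this is a continuity estimate.\<close>

lemma mixed_point_stable:
  assumes "mixed_point L t p x a" "mixed_point L t' p' x' a'"
  shows "2 * (1 - t) * ((x' - x) \<bullet> (x' - x)) \<le> (t - t') * (a' - a)
    + 2 * (t' - t) * ((x' - x) \<bullet> x') + 2 * ((x' - x) \<bullet> (p' - p))"
proof -
  have "0 \<le> t * (a' - a - 2 * (p \<bullet> (x' - x))) + 2 * (1 - t) * ((x - p) \<bullet> (x' - x))"
    using assms by (intro mixed_pointD) (auto simp: mixed_point_def)
  moreover have "0 \<le> t' * (a - a' - 2 * (p' \<bullet> (x - x'))) + 2 * (1 - t') * ((x' - p') \<bullet> (x - x'))"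
    using assms by (intro mixed_pointD) (auto simp: mixed_point_def)
  ultimately show ?thesis
    by (simp add: inner_diff_left inner_diff_right inner_commute algebra_simps)
qed

text \<open>For \<open>t < 1\<close> the choice is forced by
  \<open>mixed_point_stable\<close>.\<close>

definition mixed_map :: "'a::euclidean_space set \<Rightarrow> real \<Rightarrow> 'a \<Rightarrow> 'a" where
  "mixed_map L t p = (SOME x. \<exists>a. mixed_point L t p x a)"

lemma mixed_map:
  assumes "finite L" "L \<noteq> {}" "t \<le> 1"
  shows "\<exists>a. mixed_point L t p (mixed_map L t p) a"
proof -
  have "\<exists>x a. mixed_point L t p x a"
    using mixed_point_exists[OF assms] by metis
  then show ?thesis
    unfolding mixed_map_def by (rule someI_ex)
qed

lemma continuous_on_mixed_map:
  assumes "finite L" "L \<noteq> {}"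
  shows "continuous_on ({..<1} \<times> UNIV) (\<lambda>(t, p). mixed_map L t p)"
  unfolding continuous_on
proof
  fix z :: "real \<times> 'a" assume z: "z \<in> {..<1} \<times> UNIV"
  let ?S = "{..<1::real} \<times> (UNIV :: 'a set)"
  obtain t p where tp: "z = (t, p)" "t < 1"
    using z by auto
  have "bounded (lifted_hull L)"
    using compact_lifted_hull[OF assms(1)] by (rule compact_imp_bounded)
  then obtain B where B: "\<And>y. y \<in> lifted_hull L \<Longrightarrow> norm y \<le> B" and "0 < B"
    by (auto simp: bounded_pos)
  have bnd: "norm x \<le> B" "\<bar>a\<bar> \<le> B" if "(x, a) \<in> lifted_hull L" for x a
    using B[OF that] norm_fst_le[of x a] norm_snd_le[of a x] by auto
  \<comment> \<open>The right side of \<open>mixed_point_stable\<close> with all hull points bounded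
    by \<open>B\<close>, divided by \<open>2 * (1 - t)\<close>. Only the fixed \<open>t\<close>
    enters the denominator, and \<open>R\<close> vanishes at \<open>(t, p)\<close>.\<close>
  define R where "R t' p' = (2 * B * \<bar>t' - t\<bar> + 4 * B\<^sup>2 * \<bar>t' - t\<bar> + 4 * B * norm (p' - p)) / (2 * (1 - t))" for t' p'
  have est: "norm (mixed_map L t' p' - mixed_map L t p) \<le> sqrt (R t' p')" if t': "t' < 1" for t' p'
  proof -
    obtain a where a: "mixed_point L t p (mixed_map L t p) a"
      using mixed_map[OF assms less_imp_le[OF tp(2)]] by blast
    obtain a' where a': "mixed_point L t' p' (mixed_map L t' p') a'"
      using mixed_map[OF assms less_imp_le[OF t']] by blast
    let ?x = "mixed_map L t p" and ?x' = "mixed_map L t' p'"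
    have mem: "(?x, a) \<in> lifted_hull L" "(?x', a') \<in> lifted_hull L"
      using a a' by (auto simp: mixed_point_def)
    have diff: "norm (?x' - ?x) \<le> 2 * B"
      using norm_triangle_ineq4[of ?x' ?x] bnd[OF mem(1)] bnd[OF mem(2)] by simp
    have "(t - t') * (a' - a) \<le> \<bar>t' - t\<bar> * (2 * B)"
    proof -
      have "(t - t') * (a' - a) \<le> \<bar>t' - t\<bar> * \<bar>a' - a\<bar>"
        by (metis abs_ge_self abs_minus_commute abs_mult)
      also have "\<dots> \<le> \<bar>t' - t\<bar> * (2 * B)"
        using bnd[OF mem(1)] bnd[OF mem(2)] by (intro mult_left_mono) auto
      finally show ?thesis .
    qed
    moreover have "(t' - t) * ((?x' - ?x) \<bullet> ?x') \<le> \<bar>t' - t\<bar> * (2 * B * B)"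
    proof -
      have "(t' - t) * ((?x' - ?x) \<bullet> ?x') \<le> \<bar>t' - t\<bar> * \<bar>(?x' - ?x) \<bullet> ?x'\<bar>"
        by (metis abs_ge_self abs_mult)
      also have "\<bar>(?x' - ?x) \<bullet> ?x'\<bar> \<le> norm (?x' - ?x) * norm ?x'"
        by (rule Cauchy_Schwarz_ineq2)
      also have "\<dots> \<le> 2 * B * B"
        using diff bnd[OF mem(2)] \<open>0 < B\<close> by (intro mult_mono) auto
      finally show ?thesis
        by (simp add: mult_left_mono)
    qed
    moreover have "(?x' - ?x) \<bullet> (p' - p) \<le> 2 * B * norm (p' - p)"
    proof -
      have "(?x' - ?x) \<bullet> (p' - p) \<le> norm (?x' - ?x) * norm (p' - p)"
        by (rule norm_cauchy_schwarz)
      also have "\<dots> \<le> 2 * B * norm (p' - p)"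
        using diff by (intro mult_right_mono) auto
      finally show ?thesis .
    qed
    ultimately have "2 * (1 - t) * ((?x' - ?x) \<bullet> (?x' - ?x))
        \<le> 2 * B * \<bar>t' - t\<bar> + 4 * B\<^sup>2 * \<bar>t' - t\<bar> + 4 * B * norm (p' - p)"
      using mixed_point_stable[OF a a'] by (simp add: power2_eq_square algebra_simps)
    then have "(norm (?x' - ?x))\<^sup>2 \<le> R t' p'"
      using tp(2) by (simp add: R_def power2_norm_eq_inner field_simps)
    then show ?thesis
      by (rule real_le_rsqrt)
  qed
  have "((\<lambda>z'. sqrt (R (fst z') (snd z'))) \<longlongrightarrow> sqrt (R (fst z) (snd z))) (at z within ?S)"
    unfolding R_def using tp(2) by (intro tendsto_intros) auto
  moreover have "R (fst z) (snd z) = 0"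
    by (simp add: R_def tp)
  ultimately have "((\<lambda>z'. sqrt (R (fst z') (snd z'))) \<longlongrightarrow> 0) (at z within ?S)"
    by simp
  then have "((\<lambda>z'. mixed_map L (fst z') (snd z') - mixed_map L (fst z) (snd z)) \<longlongrightarrow> 0) (at z within ?S)"
    by (rule Lim_null_comparison[rotated]) (auto simp: eventually_at_filter tp intro!: est always_eventually)
  then show "((\<lambda>(t, p). mixed_map L t p) \<longlongrightarrow> (case z of (t, p) \<Rightarrow> mixed_map L t p)) (at z within ?S)"
    by (simp add: LIM_zero_iff case_prod_unfold)
qed

text \<open>Moving from \<open>p\<close> to the mixed point, the distance to the points of \<open>L\<close> nearest to \<open>p\<close>
  decreases.\<close>

lemma mixed_point_nearest:
  assumes x: "mixed_point L t p x a" and t: "0 \<le> t" "t < 1"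
    and l: "l \<in> L" "\<And>l'. l' \<in> L \<Longrightarrow> norm (l - p) \<le> norm (l' - p)"
  shows "0 \<le> (x - p) \<bullet> (l - x)"
proof -
  \<comment> \<open>An average of squared distances from \<open>p\<close> is at least the smallest
    one. So the first summand of the variational inequality tested at \<open>l\<close> is
    nonpositive, and the second must be nonnegative.\<close>
  have "(l - p) \<bullet> (l - p) \<le> a - 2 * (p \<bullet> x) + p \<bullet> p"
    using x l by (intro lifted_hull_sqdist_ge) (auto simp: mixed_point_def norm_le)
  then have "l \<bullet> l - a - 2 * (p \<bullet> (l - x)) \<le> 0"
    by (simp add: inner_diff_left inner_diff_right inner_commute algebra_simps)
  then have "t * (l \<bullet> l - a - 2 * (p \<bullet> (l - x))) \<le> 0"
    using t(1) by (simp add: mult_nonneg_nonpos)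
  then have "0 \<le> 2 * (1 - t) * ((x - p) \<bullet> (l - x))"
    using mixed_pointD[OF x vertex_lifted_hull[OF l(1)]] by linarith
  then show ?thesis
    using t(2) by (simp add: zero_le_mult_iff)
qed

text \<open>The triangle \<open>p\<close>, \<open>x\<close>, \<open>l\<close> has an angle of at
  least 90 degrees at \<open>x\<close>, so the side from \<open>p\<close> to \<open>l\<close> is the
  longest.\<close>

lemma mixed_point_dist_le:
  assumes "mixed_point L t p x a" "0 \<le> t" "t < 1"
    and "l \<in> L" "\<And>l'. l' \<in> L \<Longrightarrow> norm (l - p) \<le> norm (l' - p)"
  shows "norm (x - p) \<le> norm (l - p)"
proof -
  have "(l - p) \<bullet> (l - p) = (x - p) \<bullet> (x - p) + (l - x) \<bullet> (l - x) + 2 * ((x - p) \<bullet> (l - x))"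
    by (simp add: inner_diff_left inner_diff_right inner_commute algebra_simps)
  then have "(x - p) \<bullet> (x - p) \<le> (l - p) \<bullet> (l - p)"
    using mixed_point_nearest[OF assms] by simp
  then show ?thesis
    by (simp add: norm_le)
qed

text \<open>The squared distance to \<open>l\<close> is convex along the segment, and
  \<open>mixed_point_nearest\<close> says that its derivative at the end \<open>x\<close> is still
  nonpositive.\<close>

lemma mixed_point_segment_dist_le:
  assumes "mixed_point L t p x a" "0 \<le> t" "t < 1"
    and "l \<in> L" "\<And>l'. l' \<in> L \<Longrightarrow> norm (l - p) \<le> norm (l' - p)"
    and "y \<in> closed_segment p x"
  shows "norm (l - y) \<le> norm (l - p)"
proof -
  obtain s where s: "0 \<le> s" "s \<le> 1" and y: "y = (1 - s) *\<^sub>R p + s *\<^sub>R x"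
    using assms(6) by (auto simp: in_segment)
  have "(l - y) \<bullet> (l - y) = (l - p) \<bullet> (l - p) - 2 * s * ((x - p) \<bullet> (l - x))
      - s * (2 - s) * ((x - p) \<bullet> (x - p))"
    unfolding y
    by (simp add: inner_diff_left inner_diff_right inner_add_left inner_add_right inner_commute algebra_simps)
  moreover have "0 \<le> s * ((x - p) \<bullet> (l - x))" "0 \<le> s * (2 - s) * ((x - p) \<bullet> (x - p))"
    using mixed_point_nearest[OF assms(1-5)] s by auto
  ultimately have "(l - y) \<bullet> (l - y) \<le> (l - p) \<bullet> (l - p)"
    by simp
  then show ?thesis
    by (simp add: norm_le)
qed

text \<open>Complementary slackness: the function \<open>g\<close> is at least \<open>c\<close> at
  every vertex and its weighted average is \<open>c\<close>, so it equals \<open>c\<close> wherever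
  the weight is positive.\<close>

lemma mixed_point_support:
  assumes "finite L" "mixed_point L t p x a"
  obtains T where "T \<subseteq> L" "T \<noteq> {}" "x \<in> convex hull T"
    "\<And>l. l \<in> T \<Longrightarrow> t * (l \<bullet> l - 2 * (p \<bullet> l)) + 2 * (1 - t) * ((x - p) \<bullet> l)
      = t * (a - 2 * (p \<bullet> x)) + 2 * (1 - t) * ((x - p) \<bullet> x)"
proof -
  define g where "g l = t * (l \<bullet> l - 2 * (p \<bullet> l)) + 2 * (1 - t) * ((x - p) \<bullet> l)" for l
  define c where "c = t * (a - 2 * (p \<bullet> x)) + 2 * (1 - t) * ((x - p) \<bullet> x)"
  have xa: "(x, a) \<in> lifted_hull L"
    using assms(2) by (simp add: mixed_point_def)
  obtain \<mu> where \<mu>: "\<And>l. l \<in> L \<Longrightarrow> 0 \<le> \<mu> l" "sum \<mu> L = 1"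
    "(\<Sum>l\<in>L. \<mu> l *\<^sub>R l) = x" "(\<Sum>l\<in>L. \<mu> l * (l \<bullet> l)) = a"
    using lifted_hull_weights[OF assms(1) xa] by blast
  have inner_x: "w \<bullet> x = (\<Sum>l\<in>L. \<mu> l * (w \<bullet> l))" for w
    by (simp add: \<mu>(3)[symmetric] inner_sum_right)
  have ge: "c \<le> g l" if "l \<in> L" for l
    using mixed_pointD[OF assms(2) vertex_lifted_hull[OF that]]
    by (simp add: g_def c_def inner_diff_right algebra_simps)
  have "(\<Sum>l\<in>L. \<mu> l * g l) = t * ((\<Sum>l\<in>L. \<mu> l * (l \<bullet> l)) - 2 * (\<Sum>l\<in>L. \<mu> l * (p \<bullet> l)))
      + 2 * (1 - t) * (\<Sum>l\<in>L. \<mu> l * ((x - p) \<bullet> l))"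
    unfolding g_def by (simp add: sum_distrib_left sum_subtractf[symmetric] sum.distrib[symmetric] algebra_simps)
  also have "\<dots> = c"
    by (simp add: c_def \<mu>(4) inner_x[symmetric])
  finally have "(\<Sum>l\<in>L. \<mu> l * (g l - c)) = 0"
    by (simp add: right_diff_distrib sum_subtractf sum_distrib_right[symmetric] \<mu>(2))
  then have zero: "\<mu> l * (g l - c) = 0" if "l \<in> L" for l
    using that \<mu>(1) ge assms(1) by (subst (asm) sum_nonneg_eq_0_iff) auto
  define T where "T = {l \<in> L. \<mu> l \<noteq> 0}"
  have T: "T \<subseteq> L" "finite T"
    using assms(1) by (auto simp: T_def)
  have "sum \<mu> T = sum \<mu> L" "(\<Sum>l\<in>T. \<mu> l *\<^sub>R l) = (\<Sum>l\<in>L. \<mu> l *\<^sub>R l)"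
    using assms(1) by (auto simp: T_def intro!: sum.mono_neutral_left)
  then have sums: "sum \<mu> T = 1" "(\<Sum>l\<in>T. \<mu> l *\<^sub>R l) = x"
    using \<mu>(2,3) by simp_all
  then have "x \<in> convex hull T"
    using \<mu>(1) T by (auto simp: convex_hull_finite)
  moreover have "T \<noteq> {}"
    using sums(1) by auto
  moreover have "g l = c" if "l \<in> T" for l
    using zero[of l] that by (auto simp: T_def)
  ultimately show thesis
    using T by (intro that[of T]) (auto simp: g_def c_def)
qed


section \<open>Deformation of a union of balls onto its dual shape\<close>

lemma mem_dual_shape:
  "x \<in> dual_shape L \<delta> \<longleftrightarrow> (\<exists>T\<subseteq>L. T \<noteq> {} \<and> x \<in> convex hull T \<and>
     (\<exists>y. \<forall>l\<in>T. norm (l - y) \<le> \<delta> \<and> (\<forall>l'\<in>L. norm (l - y) \<le> norm (l' - y))))"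
proof -
  have *: "(\<Inter>l\<in>T. voronoi_cell L l \<inter> cball l \<delta>) \<noteq> {} \<longleftrightarrow>
      (\<exists>y. \<forall>l\<in>T. norm (l - y) \<le> \<delta> \<and> (\<forall>l'\<in>L. norm (l - y) \<le> norm (l' - y)))" for T
    unfolding ex_in_conv[symmetric]
    by (simp add: voronoi_cell_def dist_norm norm_minus_commute conj_commute)
  have "x \<in> dual_shape L \<delta> \<longleftrightarrow> (\<exists>T. (T \<subseteq> L \<and> T \<noteq> {} \<and>
      (\<Inter>l\<in>T. voronoi_cell L l \<inter> cball l \<delta>) \<noteq> {}) \<and> x \<in> convex hull T)"
    unfolding dual_shape_def dual_complex_def Union_iff bex_simps(6) by blast
  then show ?thesis
    unfolding * by (simp only: conj_ac)
qed

lemma compact_dual_shape: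
  assumes "finite L"
  shows "compact (dual_shape L \<delta>)"
proof -
  have sub: "dual_complex L \<delta> \<subseteq> (\<lambda>T. convex hull T) ` Pow L"
    unfolding dual_complex_def by blast
  then have "finite (dual_complex L \<delta>)"
    by (rule finite_subset) (simp add: assms)
  moreover have "compact \<sigma>" if "\<sigma> \<in> dual_complex L \<delta>" for \<sigma>
  proof -
    have "\<sigma> \<in> (\<lambda>T. convex hull T) ` Pow L"
      using that by (rule subsetD[OF sub])
    then obtain T where T: "\<sigma> = convex hull T" "T \<in> Pow L"
      by (rule imageE)
    have "finite T"
      using T(2) assms by (simp add: finite_subset)
    then show ?thesis
      unfolding T(1) by (intro compact_convex_hull finite_imp_compact)
  qed
  ultimately show ?thesis
    unfolding dual_shape_def by (rule compact_Union)
qed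

text \<open>The point \<open>y\<close> solves
  \<open>p = (1 - t) *\<^sub>R x + t *\<^sub>R y\<close>. After division by \<open>t\<close>, the
  two sides of the variational inequality at a vertex \<open>l\<close> differ from the squared
  distances to \<open>y\<close> by terms independent of \<open>l\<close>. Hence \<open>y\<close>
  lies in the Voronoi face dual to the Delaunay cell that carries \<open>x\<close>.\<close>

lemma mixed_point_voronoi:
  assumes "finite L" "mixed_point L t p x a" "0 < t"
  defines "y \<equiv> p + ((1 - t) / t) *\<^sub>R (p - x)"
  obtains T where "T \<subseteq> L" "T \<noteq> {}" "x \<in> convex hull T"
    "\<And>l. l \<in> T \<Longrightarrow> (l - y) \<bullet> (l - y) = a - 2 * (y \<bullet> x) + y \<bullet> y"
    "\<And>l l'. l \<in> T \<Longrightarrow> l' \<in> L \<Longrightarrow> norm (l - y) \<le> norm (l' - y)"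
proof -
  define k where "k = (1 - t) / t"
  have tk: "1 - t = t * k"
    using assms(3) by (simp add: k_def)
  have y: "y = p + k *\<^sub>R (p - x)"
    by (simp add: y_def k_def)
  obtain T where T: "T \<subseteq> L" "T \<noteq> {}" "x \<in> convex hull T"
    and eq: "\<And>l. l \<in> T \<Longrightarrow> t * (l \<bullet> l - 2 * (p \<bullet> l)) + 2 * (1 - t) * ((x - p) \<bullet> l)
      = t * (a - 2 * (p \<bullet> x)) + 2 * (1 - t) * ((x - p) \<bullet> x)"
    using mixed_point_support[OF assms(1,2)] by metis
  have dist_T: "(l - y) \<bullet> (l - y) = a - 2 * (y \<bullet> x) + y \<bullet> y" if "l \<in> T" for l
  proof -
    have "t * (l \<bullet> l - 2 * (p \<bullet> l) + 2 * k * ((x - p) \<bullet> l)) = t * (a - 2 * (p \<bullet> x) + 2 * k * ((x - p) \<bullet> x))"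
      using eq[OF that] unfolding tk by (simp add: algebra_simps)
    then have "l \<bullet> l - 2 * (p \<bullet> l) + 2 * k * ((x - p) \<bullet> l) = a - 2 * (p \<bullet> x) + 2 * k * ((x - p) \<bullet> x)"
      using assms(3) by simp
    then show ?thesis
      unfolding y by (simp add: inner_diff_left inner_diff_right inner_add_left inner_add_right inner_commute algebra_simps)
  qed
  have dist_L: "a - 2 * (y \<bullet> x) + y \<bullet> y \<le> (l - y) \<bullet> (l - y)" if "l \<in> L" for l
  proof -
    have "0 \<le> t * ((l \<bullet> l - a - 2 * (p \<bullet> (l - x))) + 2 * k * ((x - p) \<bullet> (l - x)))"
      using mixed_pointD[OF assms(2) vertex_lifted_hull[OF that]] unfolding tk by (simp add: algebra_simps)
    then have "0 \<le> (l \<bullet> l - a - 2 * (p \<bullet> (l - x))) + 2 * k * ((x - p) \<bullet> (l - x))"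
      using assms(3) by (simp add: zero_le_mult_iff)
    then show ?thesis
      unfolding y by (simp add: inner_diff_left inner_diff_right inner_add_left inner_add_right inner_commute algebra_simps)
  qed
  show thesis
    using T dist_T dist_L by (intro that[of T]) (auto simp: norm_le)
qed

text \<open>The ball about \<open>y\<close> through the vertices carrying \<open>x\<close> turns out
  to be no larger than the ball about \<open>z\<close> through the vertices carrying
  \<open>p\<close>, whose radius is at most \<open>\<delta>\<close>.\<close>

lemma mixed_point_dual_shape:
  assumes "finite L" "p \<in> dual_shape L \<delta>" "0 \<le> t" "t < 1" and x: "mixed_point L t p x a"
  shows "x \<in> dual_shape L \<delta>"
proof -
  obtain T z where T: "T \<subseteq> L" "T \<noteq> {}" "p \<in> convex hull T"
    and z: "\<And>l. l \<in> T \<Longrightarrow> norm (l - z) \<le> \<delta>" "\<And>l l'. l \<in> T \<Longrightarrow> l' \<in> L \<Longrightarrow> norm (l - z) \<le> norm (l' - z)"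
    using assms(2) unfolding mem_dual_shape by metis
  obtain m where m: "(p, m) \<in> lifted_hull T"
    using T(3) unfolding fst_lifted_hull[symmetric] by auto
  have m': "(p, m) \<in> lifted_hull L"
    using m lifted_hull_mono[OF T(1)] by blast
  note vi = mixed_pointD[OF x m']
  show ?thesis
  proof (cases "t = 0")
    \<comment> \<open>At \<open>t = 0\<close> no \<open>y\<close> is available; the mixed point is
      then the nearest point of the hull, which is \<open>p\<close> itself.\<close>
    case True
    then have "0 \<le> (x - p) \<bullet> (p - x)"
      using vi by simp
    then have "(x - p) \<bullet> (x - p) \<le> 0"
      by (simp add: inner_diff_left inner_diff_right inner_commute algebra_simps)
    then have "x = p"
      by (simp add: power2_norm_eq_inner[symmetric])
    then show ?thesis
      using assms(2) by simp
  next
    case False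
    define k where "k = (1 - t) / t"
    define y where "y = p + k *\<^sub>R (p - x)"
    define q where "q = x - p"
    have "0 < t" "0 \<le> k"
      using False assms(3,4) by (auto simp: k_def)
    then have tk: "1 - t = t * k"
      by (simp add: k_def)
    obtain T' where T': "T' \<subseteq> L" "T' \<noteq> {}" "x \<in> convex hull T'"
      "\<And>l. l \<in> T' \<Longrightarrow> (l - y) \<bullet> (l - y) = a - 2 * (y \<bullet> x) + y \<bullet> y"
      "\<And>l l'. l \<in> T' \<Longrightarrow> l' \<in> L \<Longrightarrow> norm (l - y) \<le> norm (l' - y)"
      using mixed_point_voronoi[OF assms(1) x \<open>0 < t\<close>] unfolding y_def k_def by metis
    obtain l0 where l0: "l0 \<in> T"
      using T(2) by blast
    \<comment> \<open>The squared radius of the ball about \<open>z\<close> that has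
      \<open>T\<close> on its boundary and no point of \<open>L\<close> in its interior.\<close>
    define c where "c = (l0 - z) \<bullet> (l0 - z)"
    have "m - 2 * (z \<bullet> p) + z \<bullet> z \<le> c"
      using z(2)[of _ l0] l0 T(1) by (intro lifted_hull_sqdist_le[OF m]) (auto simp: c_def norm_le)
    moreover have "c \<le> a - 2 * (z \<bullet> x) + z \<bullet> z"
      using x z(2)[OF l0] by (intro lifted_hull_sqdist_ge) (auto simp: c_def norm_le mixed_point_def)
    moreover have "2 * k * (q \<bullet> q) \<le> m - a + 2 * (p \<bullet> q)"
    proof -
      have "0 \<le> t * ((m - a + 2 * (p \<bullet> q)) - 2 * k * (q \<bullet> q))"
        using vi unfolding tk q_def by (simp add: inner_diff_left inner_diff_right inner_commute algebra_simps)
      then show ?thesis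
        using \<open>0 < t\<close> by (simp add: zero_le_mult_iff)
    qed
    \<comment> \<open>As \<open>p - y = k *\<^sub>R q\<close>, the second inequality states
      \<open>0 \<le> (x - p) \<bullet> (y - z)\<close>: the Delaunay assignment is monotone at the
      pairs \<open>(p, z)\<close> and \<open>(x, y)\<close>.\<close>
    ultimately have M: "m - p \<bullet> p + (p - z) \<bullet> (p - z) \<le> c" "k * (q \<bullet> q) \<le> q \<bullet> (p - z)"
      "2 * k * (q \<bullet> q) \<le> m - a + 2 * (p \<bullet> q)"
      by (auto simp: q_def inner_diff_left inner_diff_right inner_commute algebra_simps)
    \<comment> \<open>This square replaces Cauchy-Schwarz: together with monotonicity it bounds the
      length of \<open>k *\<^sub>R q\<close> by that of \<open>p - z\<close>.\<close>
    have "0 \<le> (p - z - k *\<^sub>R q) \<bullet> (p - z - k *\<^sub>R q)"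
      by simp
    then have "2 * (k * (q \<bullet> (p - z))) - k * (k * (q \<bullet> q)) \<le> (p - z) \<bullet> (p - z)"
      by (simp add: inner_diff_left inner_diff_right inner_commute algebra_simps)
    moreover have "k * (k * (q \<bullet> q)) \<le> k * (q \<bullet> (p - z))"
      using M(2) \<open>0 \<le> k\<close> by (rule mult_left_mono)
    ultimately have "k * (k * (q \<bullet> q)) \<le> (p - z) \<bullet> (p - z)"
      by linarith
    moreover have "a - 2 * (y \<bullet> x) + y \<bullet> y = a - p \<bullet> p - 2 * (p \<bullet> q) + 2 * k * (q \<bullet> q) + k * (k * (q \<bullet> q))"
    proof -
      have x_eq: "x = p + q" and y_eq: "y = p - k *\<^sub>R q"
        by (simp_all add: q_def y_def algebra_simps)
      show ?thesis
        unfolding y_eq x_eq by (simp add: inner_diff_left inner_diff_right inner_add_left inner_add_right inner_commute algebra_simps)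
    qed
    ultimately have "a - 2 * (y \<bullet> x) + y \<bullet> y \<le> c"
      using M(1,3) by linarith
    then have "norm (l - y) \<le> norm (l0 - z)" if "l \<in> T'" for l
      using T'(4)[OF that] by (simp add: norm_le c_def)
    then have "norm (l - y) \<le> \<delta>" if "l \<in> T'" for l
      using that z(1)[OF l0] by (meson order_trans)
    then show ?thesis
      unfolding mem_dual_shape using T'(1-3,5) by (intro exI[of _ T'] exI[of _ y] conjI ballI) auto
  qed
qed

section \<open>Nearest points and mixing parameters close to 1\<close>

lemma nearest_point_exists:
  assumes "finite L" "L \<noteq> {}"
  obtains l where "l \<in> L" "\<And>l'. l' \<in> L \<Longrightarrow> norm (l - p) \<le> norm (l' - p)"
  using assms arg_min_if_finite(1)[of L "\<lambda>l. norm (l - p)"] arg_min_least[of L _ "\<lambda>l. norm (l - p)"]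
  by metis

lemma nearest_point_union_balls:
  assumes "finite L" "p \<in> (\<Union>l\<in>L. cball l \<delta>)"
  obtains l where "l \<in> L" "norm (l - p) \<le> \<delta>" "\<And>l'. l' \<in> L \<Longrightarrow> norm (l - p) \<le> norm (l' - p)"
proof -
  obtain l' where l': "l' \<in> L" "norm (l' - p) \<le> \<delta>"
    using assms(2) by (auto simp: dist_norm)
  then obtain l where "l \<in> L" "\<And>l'. l' \<in> L \<Longrightarrow> norm (l - p) \<le> norm (l' - p)"
    using nearest_point_exists[OF assms(1), of p] by blast
  then show thesis
    using that l' by (meson order_trans)
qed

text \<open>With the weights that represent \<open>p\<close>, the average squared distance to the
  vertices is smallest at the barycentre \<open>p\<close>. It is at most
  \<open>\<delta>\<^sup>2\<close> at \<open>z\<close>, hence also at \<open>p\<close>, and some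
  vertex is no farther than average.\<close>

lemma dual_shape_subset:
  assumes "finite L"
  shows "dual_shape L \<delta> \<subseteq> (\<Union>l\<in>L. cball l \<delta>)"
proof
  fix p assume "p \<in> dual_shape L \<delta>"
  then obtain T z where T: "T \<subseteq> L" "T \<noteq> {}" "p \<in> convex hull T"
    and z: "\<And>l. l \<in> T \<Longrightarrow> norm (l - z) \<le> \<delta>"
    unfolding mem_dual_shape by metis
  obtain m where m: "(p, m) \<in> lifted_hull T"
    using T(3) unfolding fst_lifted_hull[symmetric] by auto
  obtain l where l: "l \<in> T" "\<And>l'. l' \<in> T \<Longrightarrow> norm (l - p) \<le> norm (l' - p)"
    using nearest_point_exists[OF finite_subset[OF T(1) assms] T(2)] by blast
  have "0 \<le> \<delta>"
    using z[OF l(1)] norm_ge_zero order_trans by blast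
  have "(l - p) \<bullet> (l - p) \<le> m - 2 * (p \<bullet> p) + p \<bullet> p"
    using l(2) by (intro lifted_hull_sqdist_ge[OF m]) (simp add: norm_le)
  moreover have "m - 2 * (z \<bullet> p) + z \<bullet> z \<le> \<delta>\<^sup>2"
    using z \<open>0 \<le> \<delta>\<close> by (intro lifted_hull_sqdist_le[OF m]) (simp add: power2_norm_eq_inner[symmetric])
  moreover have "0 \<le> (p - z) \<bullet> (p - z)"
    by simp
  ultimately have "(norm (l - p))\<^sup>2 \<le> \<delta>\<^sup>2"
    unfolding power2_norm_eq_inner
    by (simp add: inner_diff_left inner_diff_right inner_commute algebra_simps)
  then have "norm (l - p) \<le> \<delta>"
    using \<open>0 \<le> \<delta>\<close> by (simp add: power2_le_iff_abs_le)
  then show "p \<in> (\<Union>l\<in>L. cball l \<delta>)"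
    using l(1) T(1) by (auto simp: dist_norm)
qed

text \<open>A compactness argument: a set \<open>T\<close> that spans no simplex of the dual complex
  is nowhere on the union of balls entirely nearest, so its failure is bounded away from zero there.
  Finitely many \<open>T\<close> allow a common \<open>e\<close>.\<close>

lemma almost_nearest_dual_complex:
  fixes L :: "'a::euclidean_space set"
  assumes "finite L" "L \<noteq> {}"
  obtains e where "0 < e"
    "\<And>p T. p \<in> (\<Union>l\<in>L. cball l \<delta>) \<Longrightarrow> T \<subseteq> L \<Longrightarrow>
      (\<And>l l'. l \<in> T \<Longrightarrow> l' \<in> L \<Longrightarrow> (norm (l - p))\<^sup>2 \<le> (norm (l' - p))\<^sup>2 + e) \<Longrightarrow>
      \<exists>y. \<forall>l\<in>T. norm (l - y) \<le> \<delta> \<and> (\<forall>l'\<in>L. norm (l - y) \<le> norm (l' - y))"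
proof -
  let ?U = "\<Union>l\<in>L. cball l \<delta>"
  let ?near = "\<lambda>T e p. \<forall>l\<in>T. \<forall>l'\<in>L. (norm (l - p))\<^sup>2 \<le> (norm (l' - p))\<^sup>2 + e"
  let ?good = "\<lambda>T. \<exists>y. \<forall>l\<in>T. norm (l - y) \<le> \<delta> \<and> (\<forall>l'\<in>L. norm (l - y) \<le> norm (l' - y))"
  have "\<forall>\<^sub>F e in at_right 0. \<forall>p\<in>?U. ?near T e p \<longrightarrow> ?good T" if T: "T \<subseteq> L" for T
  proof (cases "?good T \<or> ?U = {}")
    case False
    \<comment> \<open>The total failure of \<open>T\<close> to be nearest; it is zero only where
      every point of \<open>T\<close> is nearest to \<open>p\<close>.\<close>
    define \<phi> where "\<phi> p = (\<Sum>l\<in>T. \<Sum>l'\<in>L. max 0 ((norm (l - p))\<^sup>2 - (norm (l' - p))\<^sup>2))" for p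
    have finT: "finite T"
      using T assms(1) by (rule finite_subset)
    have "compact ?U"
      using assms(1) by (intro compact_UN) auto
    moreover have "continuous_on ?U \<phi>"
      unfolding \<phi>_def by (intro continuous_intros)
    ultimately obtain p0 where p0: "p0 \<in> ?U" "\<And>p. p \<in> ?U \<Longrightarrow> \<phi> p0 \<le> \<phi> p"
      using continuous_attains_inf False by (metis (no_types, lifting))
    have "\<phi> p0 \<noteq> 0"
    proof
      assume "\<phi> p0 = 0"
      then have "max 0 ((norm (l - p0))\<^sup>2 - (norm (l' - p0))\<^sup>2) = 0" if "l \<in> T" "l' \<in> L" for l l'
        using that finT assms(1) unfolding \<phi>_def
        by (simp add: sum_nonneg_eq_0_iff sum_nonneg)
      then have near: "norm (l - p0) \<le> norm (l' - p0)" if "l \<in> T" "l' \<in> L" for l l'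
        using that by (force simp: max_def power2_le_iff_abs_le split: if_splits)
      obtain l0 where "l0 \<in> L" "norm (l0 - p0) \<le> \<delta>"
        using nearest_point_union_balls[OF assms(1) p0(1)] by blast
      then have "?good T"
        using near by (intro exI[of _ p0]) (meson order_trans)
      then show False
        using False by blast
    qed
    then have "0 < \<phi> p0"
      unfolding \<phi>_def by (simp add: order.not_eq_order_implies_strict sum_nonneg)
    \<comment> \<open>There are \<open>card T * card L\<close> summands; the added \<open>1\<close>
      makes the denominator positive and the bound in \<open>far\<close> strict.\<close>
    define b where "b = \<phi> p0 / (real (card T) * real (card L) + 1)"
    have "0 < b"
      using \<open>0 < \<phi> p0\<close> by (simp add: b_def add_nonneg_pos)
    have far: "\<not> ?near T e p" if e: "0 < e" "e < b" and p: "p \<in> ?U" for e p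
    proof
      assume near: "?near T e p"
      have "\<phi> p \<le> (\<Sum>l\<in>T. \<Sum>l'\<in>L. e)"
        unfolding \<phi>_def using near e by (intro sum_mono) (auto simp: algebra_simps)
      also have "\<dots> = real (card T) * real (card L) * e"
        by simp
      also have "\<dots> \<le> real (card T) * real (card L) * b"
        using e by (intro mult_left_mono) auto
      also have "\<dots> < \<phi> p0"
      proof -
        have "\<phi> p0 = (real (card T) * real (card L) + 1) * b"
          by (simp add: b_def add_nonneg_pos less_imp_neq[symmetric])
        then show ?thesis
          using \<open>0 < b\<close> by (simp add: algebra_simps)
      qed
      finally show False
        using p0(2)[OF p] by simp
    qed
    have "\<forall>e>0. e < b \<longrightarrow> (\<forall>p\<in>?U. ?near T e p \<longrightarrow> ?good T)"
      using far by blast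
    then show ?thesis
      unfolding eventually_at_right_field using \<open>0 < b\<close> by blast
  qed auto
  then have "\<forall>\<^sub>F e in at_right 0. \<forall>T\<in>Pow L. \<forall>p\<in>?U. ?near T e p \<longrightarrow> ?good T"
    using assms(1) by (intro eventually_ball_finite) auto
  then obtain b where b: "0 < b" "\<forall>e>0. e < b \<longrightarrow> (\<forall>T\<in>Pow L. \<forall>p\<in>?U. ?near T e p \<longrightarrow> ?good T)"
    by (auto simp: eventually_at_right_field)
  have "0 < b / 2" "b / 2 < b"
    using b(1) by simp_all
  then have *: "\<forall>T\<in>Pow L. \<forall>p\<in>?U. ?near T (b / 2) p \<longrightarrow> ?good T"
    by (rule b(2)[THEN spec, THEN mp, THEN mp])
  show thesis
  proof (rule that[of "b / 2"])
    show "?good T" if "p \<in> ?U" "T \<subseteq> L"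
      "\<And>l l'. l \<in> T \<Longrightarrow> l' \<in> L \<Longrightarrow> (norm (l - p))\<^sup>2 \<le> (norm (l' - p))\<^sup>2 + b / 2" for p T
      using *[rule_format, of T p] that by blast
  qed (use b(1) in simp)
qed

text \<open>As \<open>t\<close> tends to 1, the Voronoi point \<open>p + k *\<^sub>R (p - x)\<close>
  approaches \<open>p\<close> uniformly. The vertices carrying \<open>x\<close>, which are nearest
  to it, are then almost nearest to \<open>p\<close> and span a simplex of the dual complex.\<close>

lemma mixed_point_near_one:
  assumes "finite L" "L \<noteq> {}" "0 \<le> \<delta>"
  obtains t where "0 \<le> t" "t < 1"
    "\<And>p x a. p \<in> (\<Union>l\<in>L. cball l \<delta>) \<Longrightarrow> mixed_point L t p x a \<Longrightarrow> x \<in> dual_shape L \<delta>"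
proof -
  obtain e where e: "0 < e"
    "\<And>p T. p \<in> (\<Union>l\<in>L. cball l \<delta>) \<Longrightarrow> T \<subseteq> L \<Longrightarrow>
      (\<And>l l'. l \<in> T \<Longrightarrow> l' \<in> L \<Longrightarrow> (norm (l - p))\<^sup>2 \<le> (norm (l' - p))\<^sup>2 + e) \<Longrightarrow>
      \<exists>y. \<forall>l\<in>T. norm (l - y) \<le> \<delta> \<and> (\<forall>l'\<in>L. norm (l - y) \<le> norm (l' - y))"
    using almost_nearest_dual_complex[OF assms(1,2)] by metis
  have "bounded L"
    using assms(1) by (rule finite_imp_bounded)
  then obtain B where B: "\<And>l. l \<in> L \<Longrightarrow> norm l \<le> B" and "0 < B"
    by (auto simp: bounded_pos)
  \<comment> \<open>Moving from \<open>p\<close> to the Voronoi point changes the difference of two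
    squared distances by at most \<open>k * (4 * B * \<delta>)\<close>, as
    \<open>norm (x - p) \<le> \<delta>\<close> and points of \<open>L\<close> are at most
    \<open>2 * B\<close> apart.\<close>
  define k where "k = e / (4 * B * \<delta> + 1)"
  have "0 < k"
    using e(1) \<open>0 < B\<close> assms(3) by (simp add: k_def add_nonneg_pos)
  have k: "k * (4 * B * \<delta>) \<le> e"
  proof -
    have "k * (4 * B * \<delta> + 1) = e"
      using \<open>0 < B\<close> assms(3) by (simp add: k_def add_nonneg_pos less_imp_neq[symmetric])
    then show ?thesis
      using \<open>0 < k\<close> by (simp add: algebra_simps)
  qed
  define t where "t = 1 / (1 + k)"
  have t: "0 < t" "t < 1" "(1 - t) / t = k"
    using \<open>0 < k\<close> by (auto simp: t_def field_simps)
  have "x \<in> dual_shape L \<delta>" if p: "p \<in> (\<Union>l\<in>L. cball l \<delta>)" and x: "mixed_point L t p x a" for p x a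
  proof -
    obtain l0 where l0: "l0 \<in> L" "norm (l0 - p) \<le> \<delta>" "\<And>l'. l' \<in> L \<Longrightarrow> norm (l0 - p) \<le> norm (l' - p)"
      using nearest_point_union_balls[OF assms(1) p] by blast
    have xp: "norm (x - p) \<le> \<delta>"
      using mixed_point_dist_le[OF x _ t(2) l0(1,3)] t(1) l0(2) by simp
    obtain T where T: "T \<subseteq> L" "T \<noteq> {}" "x \<in> convex hull T"
      and vor: "\<And>l l'. l \<in> T \<Longrightarrow> l' \<in> L \<Longrightarrow> norm (l - (p + k *\<^sub>R (p - x))) \<le> norm (l' - (p + k *\<^sub>R (p - x)))"
      using mixed_point_voronoi[OF assms(1) x t(1)] unfolding t(3) by metis
    have "(norm (l - p))\<^sup>2 \<le> (norm (l' - p))\<^sup>2 + e" if l: "l \<in> T" "l' \<in> L" for l l'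
    proof -
      have "(l - (p + k *\<^sub>R (p - x))) \<bullet> (l - (p + k *\<^sub>R (p - x)))
          \<le> (l' - (p + k *\<^sub>R (p - x))) \<bullet> (l' - (p + k *\<^sub>R (p - x)))"
        using vor[OF l] by (simp add: norm_le)
      then have "(l - p) \<bullet> (l - p) \<le> (l' - p) \<bullet> (l' - p) + 2 * (k * ((x - p) \<bullet> (l' - l)))"
        by (simp add: inner_diff_left inner_diff_right inner_add_left inner_add_right inner_commute algebra_simps)
      moreover have "(x - p) \<bullet> (l' - l) \<le> \<delta> * (2 * B)"
      proof -
        have "(x - p) \<bullet> (l' - l) \<le> norm (x - p) * norm (l' - l)"
          by (rule norm_cauchy_schwarz)
        also have "norm (l' - l) \<le> 2 * B"
          using norm_triangle_ineq4[of l' l] B[OF l(2)] B[of l] l(1) T(1) by force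
        finally show ?thesis
          using xp assms(3) \<open>0 < B\<close> by (simp add: mult_mono order_trans mult_left_mono)
      qed
      then have "2 * (k * ((x - p) \<bullet> (l' - l))) \<le> e"
        using mult_left_mono[of "(x - p) \<bullet> (l' - l)" "\<delta> * (2 * B)" k] \<open>0 < k\<close> k by (simp add: algebra_simps)
      ultimately show ?thesis
        by (simp add: power2_norm_eq_inner)
    qed
    then show ?thesis
      unfolding mem_dual_shape using T e(2)[OF p T(1)] by blast
  qed
  then show thesis
    using t(1,2) by (intro that[of t]) auto
qed

text \<open>The map \<open>r\<close> is not claimed to fix \<open>S\<close>; instead
  \<open>H\<close> joins it to the identity inside \<open>S\<close>. The segments from
  \<open>p\<close> to \<open>r p\<close> provide the homotopy in \<open>U\<close>.\<close>

lemma dual_shape_deformation: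
  fixes L :: "'a::euclidean_space set"
  assumes "finite L" "0 \<le> \<delta>"
  defines "U \<equiv> \<Union>l\<in>L. cball l \<delta>" and "S \<equiv> dual_shape L \<delta>"
  obtains r H where "continuous_on U r" "r ` U \<subseteq> S"
    "\<And>p. p \<in> U \<Longrightarrow> closed_segment p (r p) \<subseteq> U" "\<And>p. p \<in> U \<Longrightarrow> norm (r p - p) \<le> \<delta>"
    "continuous_on ({0..1::real} \<times> S) H" "\<And>s p. s \<in> {0..1::real} \<Longrightarrow> p \<in> S \<Longrightarrow> H (s, p) \<in> S \<and> norm (H (s, p) - p) \<le> \<delta>"
    "\<And>p. p \<in> S \<Longrightarrow> H (0, p) = p" "\<And>p. p \<in> S \<Longrightarrow> H (1, p) = r p"
proof (cases "L = {}")
  case True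
  then have "U = {}" "S = {}"
    by (auto simp: U_def S_def dual_shape_def dual_complex_def)
  then show thesis
    by (intro that[of id snd]) auto
next
  case False
  obtain t where t: "0 \<le> t" "t < 1"
    and S: "\<And>p x a. p \<in> U \<Longrightarrow> mixed_point L t p x a \<Longrightarrow> x \<in> S"
    using mixed_point_near_one[OF assms(1) False assms(2)] unfolding U_def S_def by metis
  have cont: "continuous_on K (\<lambda>z. mixed_map L (\<tau> z) (\<pi> z))"
    if "continuous_on K \<tau>" "continuous_on K \<pi>" "\<And>z. z \<in> K \<Longrightarrow> \<tau> z < 1"
    for K :: "'c::topological_space set" and \<tau> \<pi>
    using continuous_on_compose2[OF continuous_on_mixed_map[OF assms(1) False], of K "\<lambda>z. (\<tau> z, \<pi> z)"] that
    by (auto intro: continuous_on_Pair)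
  have dist: "norm (x - p) \<le> \<delta>" "closed_segment p x \<subseteq> U"
    if p: "p \<in> U" and s: "0 \<le> s" "s < 1" and x: "mixed_point L s p x a" for p s x a
  proof -
    obtain l where l: "l \<in> L" "norm (l - p) \<le> \<delta>" "\<And>l'. l' \<in> L \<Longrightarrow> norm (l - p) \<le> norm (l' - p)"
      using nearest_point_union_balls[OF assms(1)] p unfolding U_def by blast
    show "norm (x - p) \<le> \<delta>"
      using mixed_point_dist_le[OF x s l(1,3)] l(2) by simp
    show "closed_segment p x \<subseteq> U"
    proof
      fix y assume "y \<in> closed_segment p x"
      then have "norm (l - y) \<le> \<delta>"
        using mixed_point_segment_dist_le[OF x s l(1,3)] l(2) by force
      then show "y \<in> U"
        using l(1) by (auto simp: U_def dist_norm)
    qed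
  qed
  have "S \<subseteq> U"
    unfolding S_def U_def using assms(1) by (rule dual_shape_subset)
  show thesis
  \<comment> \<open>The factor \<open>s * t\<close> ends at \<open>r\<close> for
    \<open>s = 1\<close>; for \<open>s = 0\<close> it gives the nearest-point map of the convex hull
    of \<open>L\<close>, which fixes \<open>S\<close>.\<close>
  proof (rule that[of "mixed_map L t" "\<lambda>(s, p). mixed_map L (s * t) p"])
    have ts: "t \<le> 1"
      using t by simp
    show "continuous_on U (mixed_map L t)"
      using cont[of U "\<lambda>_. t" "\<lambda>p. p"] t by auto
    show "mixed_map L t ` U \<subseteq> S"
      using mixed_map[OF assms(1) False ts] S by (metis image_subsetI)
    show "closed_segment p (mixed_map L t p) \<subseteq> U" "norm (mixed_map L t p - p) \<le> \<delta>" if "p \<in> U" for p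
      using mixed_map[OF assms(1) False ts, of p] dist[OF that t] by metis+
    have st: "0 \<le> s * t" "s * t < 1" if "s \<in> {0..1::real}" for s
      using that t by (auto intro: le_less_trans[OF mult_right_mono[of s 1 t]])
    show "continuous_on ({0..1::real} \<times> S) (\<lambda>(s, p). mixed_map L (s * t) p)"
      unfolding case_prod_unfold using st by (intro cont continuous_intros) auto
    show "(case (s, p) of (s, p) \<Rightarrow> mixed_map L (s * t) p) \<in> S \<and>
        norm ((case (s, p) of (s, p) \<Rightarrow> mixed_map L (s * t) p) - p) \<le> \<delta>" if s: "s \<in> {0..1::real}" and p: "p \<in> S" for s p
    proof -
      obtain a where a: "mixed_point L (s * t) p (mixed_map L (s * t) p) a"
        using mixed_map[OF assms(1) False less_imp_le[OF st(2)[OF s]]] by blast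
      show ?thesis
        using mixed_point_dual_shape[OF assms(1) _ st[OF s] a] dist(1)[OF _ st[OF s] a] p \<open>S \<subseteq> U\<close>
        unfolding S_def by auto
    qed
    show "(case (0, p) of (s, p) \<Rightarrow> mixed_map L (s * t) p) = p" if p: "p \<in> S" for p
    proof -
      obtain a where a: "mixed_point L 0 p (mixed_map L 0 p) a"
        using mixed_map[OF assms(1) False zero_le_one] by blast
      have "p \<in> convex hull L"
        using p unfolding S_def mem_dual_shape by (meson hull_mono subsetD)
      then obtain m where "(p, m) \<in> lifted_hull L"
        unfolding fst_lifted_hull[symmetric] by auto
      from mixed_pointD[OF a this] have "(mixed_map L 0 p - p) \<bullet> (mixed_map L 0 p - p) \<le> 0"
        by (simp add: inner_diff_left inner_diff_right inner_commute algebra_simps)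
      then show ?thesis
        by (simp add: power2_norm_eq_inner[symmetric])
    qed
  qed auto
qed


section \<open>Comparison of persistent Betti numbers\<close>

lemma compact_sublevel:
  assumes "compact Z" "continuous_on UNIV f"
  shows "compact (sublevel Z f u)"
proof -
  have "closed (\<Inter>j. {p. f p $ j \<le> u $ j})"
    using assms(2) by (intro closed_INT ballI closed_Collect_le continuous_intros)
  moreover have "sublevel Z f u = Z \<inter> (\<Inter>j. {p. f p $ j \<le> u $ j})"
    by (auto simp: sublevel_def)
  ultimately show ?thesis
    using assms(1) by (simp add: compact_Int_closed)
qed

text \<open>Up to homotopy, the inclusion of sublevel sets of \<open>Z\<close> factors through that
  of \<open>Z'\<close>. The homotopy has the larger set, at level \<open>v\<close>, to move
  in.\<close>

lemma persistent_betti_le: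
  fixes Z Z' :: "'a::metric_space set"
  assumes "compact (sublevel Z f u)"
    and "sublevel Z f u \<subseteq> sublevel Z f v" "sublevel Z' f' u' \<subseteq> sublevel Z' f' v'"
    and g: "continuous_on (sublevel Z f u) g" "g ` sublevel Z f u \<subseteq> sublevel Z' f' u'"
    and g': "continuous_on (sublevel Z' f' v') g'" "g' ` sublevel Z' f' v' \<subseteq> sublevel Z f v"
    and hom: "homotopic_with_canon (\<lambda>_. True) (sublevel Z f u) (sublevel Z f v) (g' \<circ> g) (\<lambda>x. x)"
  shows "persistent_betti TYPE('k::field) Z f i u v \<le> persistent_betti TYPE('k) Z' f' i u' v'"
  unfolding persistent_betti_def Let_def
proof (rule edim_cech_image_le[OF assms(2,3) g g'])
  let ?A = "sublevel Z f u" and ?B = "sublevel Z f v"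
    and ?A' = "sublevel Z' f' u'" and ?B' = "sublevel Z' f' v'"
  fix h :: "'a set set \<Rightarrow> ('a set list \<Rightarrow> 'k) set" assume h: "h \<in> carrier (cech_homology ?A i)"
  have id: "continuous_on ?A' (\<lambda>x. x)" "(\<lambda>x. x) ` ?A' \<subseteq> ?B'"
    using assms(3) by auto
  have idg: "continuous_on ?A ((\<lambda>x. x) \<circ> g)" "((\<lambda>x. x) \<circ> g) ` ?A \<subseteq> ?B'"
    using g assms(3) by (auto simp: comp_def)
  have "cech_map ?B' ?B g' i (cech_map ?A' ?B' (\<lambda>x. x) i (cech_map ?A ?A' g i h))
      = cech_map ?A ?B (g' \<circ> ((\<lambda>x. x) \<circ> g)) i h"
    by (simp only: cech_map_comp[OF g id h] cech_map_comp[OF idg g' h])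
  also have "g' \<circ> ((\<lambda>x. x) \<circ> g) = g' \<circ> g"
    by (simp add: comp_def)
  also have "cech_map ?A ?B (g' \<circ> g) i h = cech_map ?A ?B (\<lambda>x. x) i h"
    by (rule cech_map_homotopic[OF assms(1) hom h])
  finally show "cech_inclusion ?A ?B i h
      = cech_map ?B' ?B g' i (cech_inclusion ?A' ?B' i (cech_map ?A ?A' g i h))"
    by (simp add: cech_inclusion_eq_cech_map)
qed

lemma abs_diff_le_modulus_of_continuity:
  assumes "norm (p - q) \<le> \<delta>"
  shows "ereal \<bar>f p $ j - f q $ j\<bar> \<le> modulus_of_continuity f \<delta>"
proof -
  have "ereal \<bar>f p $ j - f q $ j\<bar> \<le> Sup {ereal \<bar>f p $ j - f p' $ j\<bar> |p p'. norm (p - p') \<le> \<delta>}"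
    using assms by (intro Sup_upper) blast
  also have "\<dots> \<le> modulus_of_continuity f \<delta>"
    unfolding modulus_of_continuity_def by (intro Max_ge) auto
  finally show ?thesis .
qed

lemma sublevel_mono: "(\<And>j. u $ j \<le> v $ j) \<Longrightarrow> sublevel Z f u \<subseteq> sublevel Z f v"
  unfolding sublevel_def by (auto intro: order_trans)

text \<open>For the first bound \<open>r\<close> maps forward and the inclusion of \<open>S\<close>
  in \<open>U\<close> maps back, with the segments as homotopy; for the second the roles are
  exchanged and \<open>H\<close> is the homotopy. Displacements of at most \<open>\<delta>\<close>
  cost at most \<open>\<omega>\<close> in level, and the gap between \<open>u\<close> and
  \<open>v\<close> leaves room for this.\<close>

lemma betti_interleaving:
  fixes f :: "'a::euclidean_space \<Rightarrow> real ^ 'n" and L :: "'a set"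
  assumes f: "continuous_on UNIV f" and "finite L" "0 \<le> \<delta>"
    and \<omega>: "\<And>j. ereal (\<omega> $ j) = modulus_of_continuity f \<delta>"
    and uv: "prec (u + \<omega>) (v - \<omega>)"
  defines "U \<equiv> \<Union>l\<in>L. cball l \<delta>" and "S \<equiv> dual_shape L \<delta>"
  shows "persistent_betti TYPE('k::field) U f i (u - \<omega>) (v + \<omega>) \<le> persistent_betti TYPE('k) S f i u v"
    and "persistent_betti TYPE('k) S f i u v \<le> persistent_betti TYPE('k) U f i (u + \<omega>) (v - \<omega>)"
proof -
  obtain r H where r: "continuous_on U r" "r ` U \<subseteq> S"
    "\<And>p. p \<in> U \<Longrightarrow> closed_segment p (r p) \<subseteq> U" "\<And>p. p \<in> U \<Longrightarrow> norm (r p - p) \<le> \<delta>"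
    and H: "continuous_on ({0..1::real} \<times> S) H"
      "\<And>s p. s \<in> {0..1::real} \<Longrightarrow> p \<in> S \<Longrightarrow> H (s, p) \<in> S \<and> norm (H (s, p) - p) \<le> \<delta>"
      "\<And>p. p \<in> S \<Longrightarrow> H (0, p) = p" "\<And>p. p \<in> S \<Longrightarrow> H (1, p) = r p"
    by (rule dual_shape_deformation[OF assms(2,3), folded U_def S_def]) (rule that; assumption)
  have f_close: "\<bar>f p $ j - f q $ j\<bar> \<le> \<omega> $ j" if "norm (p - q) \<le> \<delta>" for p q j
    using abs_diff_le_modulus_of_continuity[OF that, of f j] unfolding \<omega>[of j, symmetric] by simp
  have \<omega>_nonneg: "0 \<le> \<omega> $ j" for j
    using f_close[of 0 0 j] assms(3) by simp
  have uv': "u $ j + \<omega> $ j < v $ j - \<omega> $ j" for j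
    using uv by (simp add: prec_def)
  have U: "compact U" and S: "compact S" and SU: "S \<subseteq> U"
    unfolding U_def S_def using assms(2)
    by (auto intro!: compact_UN compact_dual_shape dual_shape_subset)
  \<comment> \<open>The one level estimate behind both maps given by \<open>r\<close> and both
    homotopies.\<close>
  have shift: "f q $ j \<le> b $ j"
    if "p \<in> sublevel Z f a" "norm (q - p) \<le> \<delta>" "a $ j + \<omega> $ j \<le> b $ j" for p q a b Z j
  proof -
    have "f p $ j \<le> a $ j"
      using that(1) by (simp add: sublevel_def)
    then show ?thesis
      using that(3) f_close[OF that(2), of j] by linarith
  qed
  show "persistent_betti TYPE('k::field) U f i (u - \<omega>) (v + \<omega>) \<le> persistent_betti TYPE('k) S f i u v"
  proof (rule persistent_betti_le[where g = r and g' = "\<lambda>x. x"])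
    let ?A = "sublevel U f (u - \<omega>)" and ?B = "sublevel U f (v + \<omega>)"
    have AU: "?A \<subseteq> U"
      by (auto simp: sublevel_def)
    show "compact ?A"
      using U f by (rule compact_sublevel)
    show "continuous_on ?A r"
      using r(1) AU by (rule continuous_on_subset)
    show "r ` ?A \<subseteq> sublevel S f u"
    proof
      fix y assume "y \<in> r ` ?A"
      then obtain p where p: "p \<in> ?A" "y = r p"
        by blast
      then have "f y $ j \<le> u $ j" for j
        using shift[OF p(1), of y j u] r(4)[of p] AU by auto
      then show "y \<in> sublevel S f u"
        using p AU r(2) by (auto simp: sublevel_def)
    qed
    show "?A \<subseteq> ?B" "sublevel S f u \<subseteq> sublevel S f v"
      by (rule sublevel_mono, use uv' \<omega>_nonneg in \<open>simp, smt (verit)\<close>)+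
    show "(\<lambda>x. x) ` sublevel S f v \<subseteq> ?B"
      using SU \<omega>_nonneg by (auto simp: sublevel_def intro: add_increasing2)
    have "homotopic_with_canon (\<lambda>_. True) ?A ?B (\<lambda>x. x) r"
    proof (rule homotopic_with_linear)
      show "continuous_on ?A r"
        using r(1) AU by (rule continuous_on_subset)
      fix p assume p: "p \<in> ?A"
      show "closed_segment p (r p) \<subseteq> ?B"
      proof
        fix y assume y: "y \<in> closed_segment p (r p)"
        then have "norm (y - p) \<le> \<delta>"
          using r(4)[of p] p AU segment_bound(1)[of y p "r p"] by force
        then have "f y $ j \<le> (v + \<omega>) $ j" for j
          using p uv'[of j] \<omega>_nonneg[of j] by (intro shift[of p U "u - \<omega>"]) auto
        then show "y \<in> ?B"
          using y r(3)[of p] p AU by (auto simp: sublevel_def)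
      qed
    qed simp
    then show "homotopic_with_canon (\<lambda>_. True) ?A ?B ((\<lambda>x. x) \<circ> r) (\<lambda>x. x)"
      by (simp add: homotopic_with_sym comp_def)
  qed simp
  show "persistent_betti TYPE('k) S f i u v \<le> persistent_betti TYPE('k) U f i (u + \<omega>) (v - \<omega>)"
  proof (rule persistent_betti_le[where g = "\<lambda>x. x" and g' = r])
    let ?A = "sublevel S f u" and ?B = "sublevel S f v"
    have AS: "?A \<subseteq> S"
      by (auto simp: sublevel_def)
    show "compact ?A"
      using S f by (rule compact_sublevel)
    show "?A \<subseteq> ?B" "sublevel U f (u + \<omega>) \<subseteq> sublevel U f (v - \<omega>)"
      by (rule sublevel_mono, use uv' \<omega>_nonneg in \<open>simp, smt (verit)\<close>)+
    show "(\<lambda>x. x) ` ?A \<subseteq> sublevel U f (u + \<omega>)"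
      using SU \<omega>_nonneg by (auto simp: sublevel_def intro: add_increasing2)
    show "continuous_on (sublevel U f (v - \<omega>)) r"
      using r(1) by (rule continuous_on_subset) (auto simp: sublevel_def)
    show "r ` sublevel U f (v - \<omega>) \<subseteq> ?B"
    proof
      fix y assume "y \<in> r ` sublevel U f (v - \<omega>)"
      then obtain p where p: "p \<in> sublevel U f (v - \<omega>)" "y = r p"
        by blast
      then have "p \<in> U"
        by (simp add: sublevel_def)
      then have "f y $ j \<le> v $ j" for j
        using shift[OF p(1), of y j v] r(4)[of p] p(2) by auto
      then show "y \<in> ?B"
        using p(2) \<open>p \<in> U\<close> r(2) by (auto simp: sublevel_def)
    qed
    have "H (s, p) \<in> ?B" if "s \<in> {0..1}" "p \<in> ?A" for s p
    proof -
      have "f (H (s, p)) $ j \<le> v $ j" for j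
        using that H(2)[of s p] AS uv'[of j] \<omega>_nonneg[of j] by (intro shift[OF that(2)]) auto
      then show ?thesis
        using H(2)[of s p] that AS by (auto simp: sublevel_def)
    qed
    moreover have "continuous_on ({0..1} \<times> ?A) H"
      using H(1) by (rule continuous_on_subset) (use AS in auto)
    ultimately have "homotopic_with_canon (\<lambda>_. True) ?A ?B (\<lambda>x. x) r"
      using H(3,4) AS by (subst homotopic_with) (auto simp: image_subset_iff intro!: exI[of _ H])
    then show "homotopic_with_canon (\<lambda>_. True) ?A ?B (r \<circ> (\<lambda>x. x)) (\<lambda>x. x)"
      by (simp add: homotopic_with_sym comp_def)
  qed simp
qed

section \<open>Locating a discontinuity point or a boundary point\<close>

lemma infnorm_pair_vec_le:
  fixes a b :: "real ^ 'n"
  assumes "\<And>j. \<bar>a $ j\<bar> \<le> w" "\<And>j. \<bar>b $ j\<bar> \<le> w"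
  shows "infnorm (a, b) \<le> w"
  unfolding infnorm_Max
proof (intro Max.boundedI)
  fix y assume "y \<in> (\<lambda>i. \<bar>(a, b) \<bullet> i\<bar>) ` Basis"
  then show "y \<le> w"
    using assms by (auto simp: Basis_prod_def Basis_vec_def inner_axis)
qed auto

text \<open>Singletons are open in the discrete codomain. The conclusion has the form that
  \<open>connected_local_const\<close> expects.\<close>

lemma locally_constant_if_not_discontinuity_point:
  assumes "K \<subseteq> Delta_plus" "z \<in> K" "\<not> discontinuity_point \<beta> z"
  shows "\<forall>\<^sub>F y in at z within K. case_prod \<beta> z = case_prod \<beta> y"
proof -
  have "topcontinuous_at (top_of_set Delta_plus) (discrete_topology UNIV) (\<lambda>(u, v). \<beta> u v) z"
    using assms by (auto simp: discontinuity_point_def)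
  then have "\<forall>V. case_prod \<beta> z \<in> V \<longrightarrow>
      (\<exists>W. openin (top_of_set Delta_plus) W \<and> z \<in> W \<and> (\<forall>y\<in>W. case_prod \<beta> y \<in> V))"
    by (simp add: topcontinuous_at_def)
  from this[THEN spec, of "{case_prod \<beta> z}"]
  obtain W where W: "openin (top_of_set Delta_plus) W" "z \<in> W" "\<forall>y\<in>W. case_prod \<beta> y = case_prod \<beta> z"
    by auto
  then obtain T where T: "open T" "W = Delta_plus \<inter> T"
    by (auto simp: openin_open)
  have "\<forall>\<^sub>F y in at z within K. y \<in> T \<and> y \<in> K"
    using T W(2) by (auto simp: eventually_at_topological)
  then show ?thesis
    by eventually_elim (use W T assms(1) in \<open>metis IntI subsetD\<close>)
qed

theorem mainTheorem5:
  fixes X L U S :: "(real ^ 'm) set" and f :: "real ^ 'm \<Rightarrow> real ^ 'n"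
    and d :: nat and \<tau> :: ereal and \<delta> :: real and i :: int
    and \<beta>\<^sub>S \<beta>\<^sub>U :: "real ^ 'n \<Rightarrow> real ^ 'n \<Rightarrow> enat"
  assumes "compact X" and "smooth_submanifold d X"
    and "triangulable_submanifold TYPE('t::euclidean_space) X"
    and "\<tau> = tube_radius X"
    and "continuous_on UNIV f"
    and "0 < \<delta>" and "ereal \<delta> < ereal (sqrt (3 / 5)) * \<tau>"
    and "finite L" and "L \<subseteq> X" and "general_position L"
    and "\<forall>p\<in>X. \<exists>l\<in>L. norm (p - l) < \<delta> / 2"
    and "U = (\<Union>l\<in>L. cball l \<delta>)"
    and "S = dual_shape L \<delta>"
    and "\<beta>\<^sub>S = persistent_betti TYPE('k::field) S f i"
    and "\<beta>\<^sub>U = persistent_betti TYPE('k) U f i"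
  shows "(\<forall>\<omega> :: real ^ 'n. (\<forall>j. ereal (\<omega> $ j) = modulus_of_continuity f \<delta>) \<longrightarrow>
            (\<forall>u v. (u, v) \<in> Delta_plus \<and> prec (u + \<omega>) (v - \<omega>) \<longrightarrow>
               \<beta>\<^sub>U (u - \<omega>) (v + \<omega>) \<le> \<beta>\<^sub>S u v \<and> \<beta>\<^sub>S u v \<le> \<beta>\<^sub>U (u + \<omega>) (v - \<omega>))) \<and>
         (\<forall>u v. (u, v) \<in> Delta_plus \<and> \<beta>\<^sub>U u v \<noteq> \<beta>\<^sub>S u v \<longrightarrow>
            (\<exists>u' v'. ereal (infnorm ((u, v) - (u', v'))) \<le> modulus_of_continuity f \<delta> \<and>
               ((u', v') \<in> frontier Delta_plus \<or> discontinuity_point \<beta>\<^sub>U (u', v'))))"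
proof -
  have interleaved: "\<beta>\<^sub>U (u - \<omega>) (v + \<omega>) \<le> \<beta>\<^sub>S u v \<and> \<beta>\<^sub>S u v \<le> \<beta>\<^sub>U (u + \<omega>) (v - \<omega>)"
    if "\<forall>j. ereal (\<omega> $ j) = modulus_of_continuity f \<delta>" "prec (u + \<omega>) (v - \<omega>)" for \<omega> u v
    unfolding assms(12-15) using that assms(5,6,8)
    by (intro conjI betti_interleaving) auto
  have "\<exists>u' v'. ereal (infnorm ((u, v) - (u', v'))) \<le> modulus_of_continuity f \<delta> \<and>
      ((u', v') \<in> frontier Delta_plus \<or> discontinuity_point \<beta>\<^sub>U (u', v'))"
    if uv: "(u, v) \<in> Delta_plus" and ne: "\<beta>\<^sub>U u v \<noteq> \<beta>\<^sub>S u v" for u v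
  proof (rule ccontr)
    assume none: "\<not> ?thesis"
    \<comment> \<open>The closed max-norm ball of radius \<open>\<Omega>(\<delta>)\<close>; for an
      infinite modulus it is the whole space. Starlikeness gives connectedness without separating
      that case.\<close>
    define K where "K = {z. ereal (infnorm ((u, v) - z)) \<le> modulus_of_continuity f \<delta>}"
    have nonneg: "0 \<le> modulus_of_continuity f \<delta>"
      using abs_diff_le_modulus_of_continuity[of 0 0 \<delta> f] assms(6) by (simp add: zero_ereal_def)
    then have uvK: "(u, v) \<in> K"
      by (simp add: K_def infnorm_0 zero_ereal_def)
    have "starlike K"
      unfolding starlike_def
    proof (intro bexI[OF _ uvK] ballI subsetI)
      fix z y assume z: "z \<in> K" and "y \<in> closed_segment (u, v) z"
      then obtain s where s: "0 \<le> s" "s \<le> 1" "y = (1 - s) *\<^sub>R (u, v) + s *\<^sub>R z"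
        by (auto simp: in_segment)
      have "(u, v) - y = s *\<^sub>R ((u, v) - z)"
        unfolding s(3) by (simp add: algebra_simps)
      then have "infnorm ((u, v) - y) = s * infnorm ((u, v) - z)"
        using s(1) by (simp add: infnorm_mul)
      also have "\<dots> \<le> infnorm ((u, v) - z)"
        using s by (intro mult_left_le_one_le infnorm_pos_le)
      finally show "y \<in> K"
        using z by (auto simp: K_def intro: order_trans[rotated])
    qed
    then have "connected K"
      by (rule starlike_imp_connected)
    have "K \<inter> frontier Delta_plus = {}"
      using none by (auto simp: K_def)
    \<comment> \<open>A connected set that meets \<open>Delta_plus\<close> but not its frontier
      stays inside.\<close>
    then have "K \<subseteq> Delta_plus"
      using connected_Int_frontier[OF \<open>connected K\<close>, of Delta_plus] uv uvK by blast
    have const: "\<beta>\<^sub>U u v = \<beta>\<^sub>U u' v'" if "(u', v') \<in> K" for u' v'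
    proof -
      have "\<forall>z\<in>K. \<forall>\<^sub>F y in at z within K. case_prod \<beta>\<^sub>U z = case_prod \<beta>\<^sub>U y"
      proof
        fix z assume z: "z \<in> K"
        have "\<not> discontinuity_point \<beta>\<^sub>U z"
          using none z by (cases z) (auto simp: K_def)
        with \<open>K \<subseteq> Delta_plus\<close> z
        show "\<forall>\<^sub>F y in at z within K. case_prod \<beta>\<^sub>U z = case_prod \<beta>\<^sub>U y"
          by (rule locally_constant_if_not_discontinuity_point)
      qed
      from connected_local_const[OF \<open>connected K\<close> uvK that this] show ?thesis
        by simp
    qed
    \<comment> \<open>An infinite modulus would put this diagonal point into \<open>K\<close>,
      against \<open>K \<subseteq> Delta_plus\<close>; so the modulus is a real number
      \<open>w\<close>.\<close>
    have "(u, u) \<notin> Delta_plus"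
      by (simp add: Delta_plus_def prec_def)
    then have "(u, u) \<notin> K"
      using \<open>K \<subseteq> Delta_plus\<close> by blast
    then have "modulus_of_continuity f \<delta> \<noteq> \<infinity>"
      by (auto simp: K_def)
    then obtain w where w: "modulus_of_continuity f \<delta> = ereal w" "0 \<le> w"
      using nonneg by (cases "modulus_of_continuity f \<delta>") auto
    define \<omega> :: "real ^ 'n" where "\<omega> = (\<chi> j. w)"
    \<comment> \<open>Two opposite corners of \<open>K\<close>. The second lies in
      \<open>Delta_plus\<close>, which is the hypothesis of the first claim; constancy of
      \<open>\<beta>\<^sub>U\<close> on \<open>K\<close> then makes both bounds equal to
      \<open>\<beta>\<^sub>U u v\<close>.\<close>
    have "(u - \<omega>, v + \<omega>) \<in> K" "(u + \<omega>, v - \<omega>) \<in> K"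
      using w by (auto simp: K_def \<omega>_def intro!: infnorm_pair_vec_le)
    moreover from this have "prec (u + \<omega>) (v - \<omega>)"
      using \<open>K \<subseteq> Delta_plus\<close> by (auto simp: Delta_plus_def)
    then have "\<beta>\<^sub>U (u - \<omega>) (v + \<omega>) \<le> \<beta>\<^sub>S u v \<and> \<beta>\<^sub>S u v \<le> \<beta>\<^sub>U (u + \<omega>) (v - \<omega>)"
      using w by (intro interleaved) (auto simp: \<omega>_def)
    ultimately show False
      using const ne by (metis order_antisym)
  qed
  then show ?thesis
    using interleaved by blast
qed

end
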